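(* Let $0<\alpha<1$, $a>0$, and let $\min\{\alpha,1-\alpha\}<\gamma\le 2$. Let $k:\{(x,y)\in\mathbb{R}^2 \mid 0\le y\le x\le a\}\to\mathbb{R}$ have Lipschitz continuous partial derivatives up to order $2$ and satisfy $k(x,x)=1$ for $0\le x\le a$. Let $f:[0,a]\to\mathbb{R}$ and suppose $u\in F^{\gamma}[0,a]$ solves $$\frac{1}{\Gamma(\alpha)}\int_0^x (x-y)^{\alpha-1}k(x,y)u(y)\,dy=f(x),\qquad 0\le x\le a .$$ For a positive integer $N$ let $h=a/N$ and $x_n=nh$ (for integer and half-integer $n$), let $\delta>0$, and let $f_1^\delta,\dots,f_N^\delta\in\mathbb{R}$ satisfy $|f_n^\delta-f(x_n)|\le\delta$ for $n=1,\dots,N$. Let $u^\delta_{1/2},u^\delta_{3/2},\dots,u^\delta_{N-1/2}$ be determined by $$h^\alpha\sum_{j=1}^n\omega_{n-j}\,k(x_n,x_{j-1/2})\,u^\delta_{j-1/2}=f_n^\delta,\qquad n=1,2,\dots,N,$$ with $\omega_s=\frac{1}{\Gamma(\alpha+1)}\{(s+1)^\alpha-s^\alpha\}$ for $s=0,1,\dots$. (1) If $\alpha\le1/2$ and $\alpha<\gamma\le\alpha+1$, then for $h=h(\delta)\sim\delta^{1/\gamma}$ we have $$\max_{n=1,\dots,N}|u^\delta_{n-1/2}-u(x_{n-1/2})|=O\big(\delta^{1-\alpha/\gamma}\big)\quad\text{as }\delta\to0.$$ (2) Suppose one of the following two conditions holds: (a) $\alpha\ge1/2$ and $1-\alpha<\gamma\le2-\alpha$;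 or (b) $\gamma>2-\alpha$ and $u(0)=u'(0)=0$. Then for $h=h(\delta)\sim\delta^{1/(\gamma-1+2\alpha)}$ we have $$\max_{n=1,\dots,N}|u^\delta_{n-1/2}-u(x_{n-1/2})|=O\Big(\delta^{\,1-\frac{\alpha}{\gamma-1+2\alpha}}\Big)\quad\text{as }\delta\to0.$$
   Context: For $c<d$, $m\in\{0,1,\dots\}$ and $0<\beta\le1$, $F^{m+\beta}[c,d]$ is the space of all $\varphi\in C^m[c,d]$ for which there is a constant $L\ge0$ with $|\varphi^{(m)}(x)-\varphi^{(m)}(y)|\le L|x-y|^\beta$ for all $x,y\in[c,d]$. (So $F^1$ means Lipschitz continuous, and $F^2$ means $C^1$ with Lipschitz continuous derivative.) The step sizes are $h=a/N$ with $N$ a positive integer. For step sizes $h=h(\delta)=a/N(\delta)$, the notation $h\sim\delta^\beta$ as $\delta\to0$ means that there are constants $c_2\ge c_1>0$ with $c_1h\le\delta^\beta\le c_2h$ for all sufficiently small $\delta$. The $O$-statements hold for all sufficiently small $\delta$ with a constant independent of $\delta$ and of the noisy data $f_n^\delta$. For sufficiently small $h$ the scheme is uniquely solvable recursively, since $k(x_n,x_{n-1/2})\neq0$ then. *)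

theory Defs
  imports "HOL-Analysis.Analysis"
begin

text \<open>
  The space $F^{\gamma}[c,d]$; the decomposition $\gamma = m + \beta$ with $0 < \beta \le 1$ is
  unique, and \<open>D i\<close> is the \<open>i\<close>-th derivative (one-sided at the end points).
\<close>
definition F_space :: "real \<Rightarrow> real \<Rightarrow> real \<Rightarrow> (real \<Rightarrow> real) set" where
  "F_space \<gamma> c d = {\<phi>. \<exists>m \<beta> D.
     \<gamma> = real m + \<beta> \<and> 0 < \<beta> \<and> \<beta> \<le> 1 \<and>
     (\<forall>x\<in>{c..d}. D 0 x = \<phi> x) \<and>
     (\<forall>i<m. \<forall>x\<in>{c..d}. (D i has_real_derivative D (Suc i) x) (at x within {c..d})) \<and>
     continuous_on {c..d} (D m) \<and>
     (\<exists>L\<ge>0. \<forall>x\<in>{c..d}. \<forall>y\<in>{c..d}. \<bar>D m x - D m y\<bar> \<le> L * \<bar>x - y\<bar> powr \<beta>)}"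

definition triangle :: "real \<Rightarrow> (real \<times> real) set" where
  "triangle a = {(x, y). 0 \<le> y \<and> y \<le> x \<and> x \<le> a}"

text \<open>
  \<open>D i j\<close> is the partial derivative $\partial_x^i \partial_y^j k$, in either order of
  differentiation, taken along the horizontal and vertical sections of the closed triangle.
  These sections degenerate to a point only at $(a,a)$ (in $x$) and at $(0,0)$ (in $y$); the
  derivative condition is void there, and the value of the partial derivative is its continuous
  extension, by the Lipschitz condition.
\<close>
definition lipschitz_partials :: "nat \<Rightarrow> real \<Rightarrow> (real \<Rightarrow> real \<Rightarrow> real) \<Rightarrow> bool" where
  "lipschitz_partials r a k \<longleftrightarrow> (\<exists>D.
     (\<forall>(x, y)\<in>triangle a. D 0 0 x y = k x y) \<and>
     (\<forall>i j. i + j < r \<longrightarrow> (\<forall>(x, y)\<in>triangle a.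
        ((\<lambda>s. D i j s y) has_real_derivative D (Suc i) j x y) (at x within {y..a}) \<and>
        ((\<lambda>t. D i j x t) has_real_derivative D i (Suc j) x y) (at y within {0..x}))) \<and>
     (\<forall>i j. i + j \<le> r \<longrightarrow> (\<exists>L. L-lipschitz_on (triangle a) (\<lambda>(x, y). D i j x y))))"

definition abel_solution ::
  "real \<Rightarrow> real \<Rightarrow> (real \<Rightarrow> real \<Rightarrow> real) \<Rightarrow> (real \<Rightarrow> real) \<Rightarrow> (real \<Rightarrow> real) \<Rightarrow> bool" where
  "abel_solution \<alpha> a k f u \<longleftrightarrow> (\<forall>x\<in>{0..a}.
     1 / Gamma \<alpha> * integral {0..x} (\<lambda>y. (x - y) powr (\<alpha> - 1) * k x y * u y) = f x)"

definition omega :: "real \<Rightarrow> nat \<Rightarrow> real" where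
  "omega \<alpha> s = 1 / Gamma (\<alpha> + 1) * ((real s + 1) powr \<alpha> - real s powr \<alpha>)"

definition step :: "real \<Rightarrow> nat \<Rightarrow> real" where
  "step a N = a / real N"

definition grid :: "real \<Rightarrow> nat \<Rightarrow> real \<Rightarrow> real" where
  "grid a N s = s * step a N"

text \<open>In the next two definitions \<open>v n\<close> stands for $u^\delta_{n-1/2}$ and \<open>g n\<close> for $f^\delta_n$.\<close>
definition midpoint_scheme ::
  "real \<Rightarrow> real \<Rightarrow> (real \<Rightarrow> real \<Rightarrow> real) \<Rightarrow> nat \<Rightarrow> (nat \<Rightarrow> real) \<Rightarrow> (nat \<Rightarrow> real) \<Rightarrow> bool" where
  "midpoint_scheme \<alpha> a k N g v \<longleftrightarrow> (\<forall>n\<in>{1..N}.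
     step a N powr \<alpha> *
       (\<Sum>j=1..n. omega \<alpha> (n - j) * k (grid a N (real n)) (grid a N (real j - 1/2)) * v j) = g n)"

definition max_error :: "real \<Rightarrow> nat \<Rightarrow> (real \<Rightarrow> real) \<Rightarrow> (nat \<Rightarrow> real) \<Rightarrow> real" where
  "max_error a N u v = (MAX n\<in>{1..N}. \<bar>v n - u (grid a N (real n - 1/2))\<bar>)"

definition noisy_data :: "real \<Rightarrow> (real \<Rightarrow> real) \<Rightarrow> nat \<Rightarrow> real \<Rightarrow> (nat \<Rightarrow> real) \<Rightarrow> bool" where
  "noisy_data a f N \<delta> g \<longleftrightarrow> (\<forall>n\<in>{1..N}. \<bar>g n - f (grid a N (real n))\<bar> \<le> \<delta>)"

text \<open>The relation $h(\delta) = a/N(\delta) \sim \delta^\beta$ as $\delta \to 0$.\<close>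
definition step_sim :: "real \<Rightarrow> (real \<Rightarrow> nat) \<Rightarrow> real \<Rightarrow> bool" where
  "step_sim a N \<beta> \<longleftrightarrow> (\<exists>c\<^sub>1 c\<^sub>2. 0 < c\<^sub>1 \<and> c\<^sub>1 \<le> c\<^sub>2 \<and>
     (\<forall>\<^sub>F \<delta> in at_right 0. c\<^sub>1 * step a (N \<delta>) \<le> \<delta> powr \<beta> \<and> \<delta> powr \<beta> \<le> c\<^sub>2 * step a (N \<delta>)))"

end

theory Submission
  imports Defs
begin

text \<open>
  Up to the factor \<open>Gamma (\<alpha> + 1)\<close> the weights are \<open>w s = (s + 1) powr \<alpha> - s powr \<alpha>\<close>. They are
  log-convex, so by Kaluza's theorem all coefficients but the first of the reciprocal power series
  are nonpositive. Hence the reciprocal has \<open>l\<^sup>1\<close>-norm at most 2 and partial sums between 0 and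
  \<open>(s + 1) powr - \<alpha>\<close>. Convolving the scheme with the reciprocal turns it, since \<open>k x x = 1\<close>,
  into the identity plus a matrix with entries \<open>O(h)\<close>, and Gronwall's inequality bounds the error
  by the convolved right-hand side. The noise contributes \<open>O(\<delta> h powr - \<alpha>)\<close>. The convolved
  quadrature error is \<open>O(h powr min \<gamma> 1)\<close> without any loss of order, because the kernels
  \<open>(s + t) powr (\<alpha> - 1)\<close>, \<open>0 \<le> t \<le> 1\<close>, differ from their means by a summable amount; this
  gives (1) and (2)(a). For (2)(b) the part of the integrand that is linear on each cell is
  summed by parts, where \<open>u 0 = u' 0 = 0\<close> controls the boundary term; its contribution is
  \<open>O(h powr (\<gamma> - 1 + \<alpha>))\<close>.
\<close>

section \<open>Weights and moments\<close>

text \<open>If the convolved quadrature error is O(h powr \<tau>), it balances the noise term when h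
  is of order \<delta> powr (1 / (\<tau> + \<alpha>)). Part (1) asks for \<tau> = \<gamma> -
  \<alpha> and part (2) for \<tau> = \<gamma> - 1 + \<alpha>. In (1) and (2)(a) this is at most min
  \<gamma> 1, so Hoelder continuity of u suffices. In (2)(b) it exceeds 1, and that is the obstacle:
  the linear part of the integrand has mean zero on each cell, but the kernel is not constant there,
  so a multiple of h survives in every cell. The moments of 1/2 - t are summable, hence one
  difference can be moved from the inverse weights onto the derivative of the integrand. This gains
  h powr (\<gamma> - 1), while adding up the partial sums of the inverse weights costs h powr
  (\<alpha> - 1). With the factor h of the linear part the exponents add up to \<gamma> - 1 +
  \<alpha>.\<close>

definition weight :: "real \<Rightarrow> nat \<Rightarrow> real" where
  "weight \<alpha> s = (real s + 1) powr \<alpha> - real s powr \<alpha>"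

text \<open>The factor \<alpha> makes the integral over the unit cell equal to
  \<open>weight \<alpha> s\<close>. Since \<open>0 powr x = 0\<close>, the value at s = t = 0 is 0
  instead of infinite, so monotonicity in t breaks at that one point.\<close>

definition abel_kernel :: "real \<Rightarrow> nat \<Rightarrow> real \<Rightarrow> real" where
  "abel_kernel \<alpha> s t = \<alpha> * (real s + t) powr (\<alpha> - 1)"

text \<open>The coordinate t runs backwards from the right end of a cell, and that end lies s cells
  before the evaluation point; the singularity therefore sits at s = t = 0.\<close>

definition moment :: "real \<Rightarrow> nat \<Rightarrow> (real \<Rightarrow> real) \<Rightarrow> real" where
  "moment \<alpha> s f = integral {0..1} (\<lambda>t. abel_kernel \<alpha> s t * f t)"

text \<open>Convolution with these coefficients inverts the lower triangular Toeplitz matrix of the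
  weights; formal power series raise no question of convergence.\<close>

definition weight_inv :: "real \<Rightarrow> nat \<Rightarrow> real" where
  "weight_inv \<alpha> = fps_nth (inverse (Abs_fps (weight \<alpha>)))"

definition weight_inv_sum :: "real \<Rightarrow> nat \<Rightarrow> real" where
  "weight_inv_sum \<alpha> n = (\<Sum>i\<le>n. weight_inv \<alpha> i)"

section \<open>Convolution of sequences as multiplication of power series\<close>

definition conv :: "(nat \<Rightarrow> real) \<Rightarrow> (nat \<Rightarrow> real) \<Rightarrow> nat \<Rightarrow> real" where
  "conv p q s = (\<Sum>i\<le>s. p (s - i) * q i)"

lemma conv_fps: "conv p q s = fps_nth (Abs_fps p * Abs_fps q) s"
proof -
  have "fps_nth (Abs_fps q * Abs_fps p) s = (\<Sum>i\<le>s. p (s - i) * q i)"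
    unfolding fps_mult_nth by (simp add: atLeast0AtMost mult.commute)
  then show ?thesis
    by (metis conv_def mult.commute)
qed

lemma conv_add: "conv p (\<lambda>i. q i + r i) s = conv p q s + conv p r s"
  by (simp add: conv_def algebra_simps sum.distrib)

lemma conv_cmult: "conv p (\<lambda>i. c * q i) s = c * conv p q s"
  by (simp add: conv_def algebra_simps sum_distrib_left)

lemma conv_mono:
  assumes "\<And>i. i \<le> s \<Longrightarrow> 0 \<le> p i" and "\<And>i. i \<le> s \<Longrightarrow> \<bar>q i\<bar> \<le> r i"
  shows "\<bar>conv p q s\<bar> \<le> conv p r s"
  unfolding conv_def
  by (rule order_trans[OF sum_abs])
     (auto intro!: sum_mono mult_mono assms simp: abs_mult)

lemma conv_abs_le:
  assumes "\<And>i. i \<le> s \<Longrightarrow> \<bar>q i\<bar> \<le> r i"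
  shows "\<bar>conv p q s\<bar> \<le> conv (\<lambda>i. \<bar>p i\<bar>) r s"
  unfolding conv_def
  by (rule order_trans[OF sum_abs])
     (auto intro!: sum_mono mult_left_mono assms simp: abs_mult)

text \<open>The pairs with i + j < n lie in the full square: this is Young's inequality in l1 for
  truncated nonnegative sequences.\<close>

lemma sum_conv_le:
  assumes "\<And>i. 0 \<le> p i" "\<And>i. 0 \<le> q i"
  shows "(\<Sum>s<n. conv p q s) \<le> (\<Sum>i<n. p i) * (\<Sum>i<n. q i)"
proof -
  have "(\<Sum>s<n. conv p q s) = (\<Sum>(s, i)\<in>(SIGMA s:{..<n}. {..s}). p (s - i) * q i)"
    unfolding conv_def by (subst sum.Sigma) auto
  also have "\<dots> = (\<Sum>(i, j)\<in>{(i, j). i + j < n}. p i * q j)"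
    by (rule sum.reindex_bij_witness[of _ "\<lambda>(i, j). (i + j, j)" "\<lambda>(s, i). (s - i, i)"]) auto
  also have "\<dots> \<le> (\<Sum>(i, j)\<in>{..<n} \<times> {..<n}. p i * q j)"
    by (rule sum_mono2) (auto simp: assms)
  also have "\<dots> = (\<Sum>i<n. p i) * (\<Sum>i<n. q i)"
    by (simp add: sum_product sum.cartesian_product)
  finally show ?thesis .
qed

text \<open>Multiply the recursion for index \<open>Suc m\<close> by \<open>w m\<close> and the one
  for index \<open>m\<close> by \<open>w (Suc m)\<close>; in the difference the terms free of c
  cancel. It expresses \<open>c (Suc m) * w m\<close> through earlier \<open>c i\<close>,
  nonpositive by induction, times differences that log-convexity makes nonnegative.\<close>

lemma kaluza:
  fixes w :: "nat \<Rightarrow> real"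
  assumes pos: "\<And>n. 0 < w n" and w0: "w 0 = 1"
    and logconv: "\<And>n. w (Suc n) * w (Suc n) \<le> w n * w (Suc (Suc n))"
    and "0 < n"
  shows "fps_nth (inverse (Abs_fps w)) n \<le> 0"
proof -
  define c where "c = fps_nth (inverse (Abs_fps w))"
  have rec: "(\<Sum>i=1..n. c i * w (n - i)) = - w n" if "0 < n" for n
  proof -
    have "inverse (Abs_fps w) * Abs_fps w = 1"
      by (rule inverse_mult_eq_1) (simp add: w0)
    then have "(\<Sum>i=0..n. c i * w (n - i)) = fps_nth 1 n"
      unfolding c_def by (metis (no_types, lifting) fps_mult_nth fps_nth_Abs_fps sum.cong)
    with that show ?thesis
      by (simp add: sum.atLeast_Suc_atMost c_def w0)
  qed
  \<comment> \<open>Log-convexity as growth of the quotient \<open>w (Suc n) / w n\<close>,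
    cross-multiplied to avoid division.\<close>
  have ratio: "w (Suc m) * w n \<le> w (Suc n) * w m" if "m \<le> n" for m n
    using that
  proof (induction n rule: dec_induct)
    case (step n)
    have "(w (Suc m) * w (Suc n)) * w n \<le> w (Suc n) * (w (Suc n) * w m)"
      using mult_left_mono[OF step.IH less_imp_le[OF pos[of "Suc n"]]] by (simp add: algebra_simps)
    also have "\<dots> \<le> (w n * w (Suc (Suc n))) * w m"
      using mult_right_mono[OF logconv[of n] less_imp_le[OF pos[of m]]] by (simp add: algebra_simps)
    finally show ?case
      using pos[of n] by (simp add: algebra_simps)
  qed (simp add: mult.commute)
  have "c n \<le> 0" if "0 < n" for n
    using that
  proof (induction n rule: less_induct)
    case (less n)
    obtain m where n: "n = Suc m"
      using less.prems by (cases n) auto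
    show ?case
    proof (cases "m = 0")
      case True
      then show ?thesis
        using rec[of 1] n pos[of 1] w0 by simp
    next
      case False
      have "c n * w m = - (w (Suc m) * w m) - (\<Sum>i=1..m. c i * w (Suc m - i)) * w m"
        using arg_cong[OF rec[of n], of "\<lambda>z. w m * z"] n w0 by (simp add: algebra_simps)
      also have "\<dots> = (\<Sum>i=1..m. c i * (w (m - i) * w (Suc m) - w (Suc (m - i)) * w m))"
      proof -
        have "- (w (Suc m) * w m) = (\<Sum>i=1..m. c i * w (m - i)) * w (Suc m)"
          using rec[of m] False by simp
        then have "- (w (Suc m) * w m) - (\<Sum>i=1..m. c i * w (Suc m - i)) * w m
            = (\<Sum>i=1..m. c i * w (m - i) * w (Suc m)) - (\<Sum>i=1..m. c i * w (Suc m - i) * w m)"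
          by (simp only: sum_distrib_right)
        also have "\<dots> = (\<Sum>i=1..m. c i * (w (m - i) * w (Suc m) - w (Suc (m - i)) * w m))"
          unfolding sum_subtractf[symmetric]
          by (intro sum.cong) (auto simp: Suc_diff_le algebra_simps)
        finally show ?thesis .
      qed
      also have "\<dots> \<le> 0"
      proof (rule sum_nonpos)
        fix i assume i: "i \<in> {1..m}"
        then show "c i * (w (m - i) * w (Suc m) - w (Suc (m - i)) * w m) \<le> 0"
          using less.IH[of i] ratio[of "m - i" m] n
          by (intro mult_nonpos_nonneg) (auto simp: algebra_simps)
      qed
      finally show ?thesis
        using pos[of m] by (simp add: mult_le_0_iff)
    qed
  qed
  then show ?thesis
    using \<open>0 < n\<close> by (simp add: c_def)
qed

text \<open>Pointwise comparisons of kernels may fail at t = 0, where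
  \<open>abel_kernel \<alpha> 0\<close> has its default value; dropping that point changes no
  integral.\<close>

lemma has_integral_half_open:
  fixes f :: "real \<Rightarrow> real"
  assumes "(f has_integral i) {0..1}"
  shows "(f has_integral i) {0<..1}"
proof -
  have "negligible {x \<in> {0..1} - {0<..1}. f x \<noteq> 0}"
    by (rule negligible_subset[of "{0}"]) auto
  moreover have "{x \<in> {0<..1} - {0..1}. f x \<noteq> 0} = {}"
    by auto
  then have "negligible {x \<in> {0<..1} - {0..1}. f x \<noteq> 0}"
    by (metis negligible_empty)
  ultimately show ?thesis
    using assms has_integral_spike_set_eq[of "{0..1}" "{0<..1}" f i] by blast
qed

section \<open>Integrals of the Abel kernel over unit cells\<close>

context
  fixes \<alpha> :: real
  assumes \<alpha>: "0 < \<alpha>" "\<alpha> < 1"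
begin

lemma abel_kernel_nonneg: "0 \<le> abel_kernel \<alpha> s t"
  using \<alpha> by (simp add: abel_kernel_def)

lemma abel_kernel_antimono: "0 < real s + t \<Longrightarrow> t \<le> t' \<Longrightarrow> abel_kernel \<alpha> s t' \<le> abel_kernel \<alpha> s t"
  using \<alpha> by (auto simp: abel_kernel_def intro!: powr_mono2')

lemma abel_kernel_Suc: "abel_kernel \<alpha> (Suc s) t = abel_kernel \<alpha> s (t + 1)"
  by (simp add: abel_kernel_def algebra_simps)

lemma abel_kernel_has_integral: "(abel_kernel \<alpha> s has_integral weight \<alpha> s) {0..1}"
proof -
  have "((\<lambda>t. \<alpha> * (real s + t) powr (\<alpha> - 1)) has_integral
      ((real s + 1) powr \<alpha> - (real s + 0) powr \<alpha>)) {0..1}"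
  \<comment> \<open>For s = 0 the antiderivative is continuous at t = 0 but not differentiable
    there, so the derivative is taken in the open interval only.\<close>
  proof (rule fundamental_theorem_of_calculus_interior)
    show "continuous_on {0..1} (\<lambda>t. (real s + t) powr \<alpha>)"
      using \<alpha> by (intro continuous_on_powr' continuous_intros) auto
    show "((\<lambda>t. (real s + t) powr \<alpha>) has_vector_derivative \<alpha> * (real s + t) powr (\<alpha> - 1)) (at t)"
      if "t \<in> {0<..<1}" for t
      unfolding has_real_derivative_iff_has_vector_derivative[symmetric]
      using that by (auto intro!: derivative_eq_intros)
  qed simp
  then show ?thesis
    by (simp add: abel_kernel_def[abs_def] weight_def)
qed

text \<open>For s = 0 the kernel is unbounded, so the product need not be continuous. The kernel is
  nonnegative and integrable, hence absolutely integrable, and the other factor is bounded and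
  measurable.\<close>

lemma abel_kernel_mult_integrable:
  assumes "continuous_on {0..1} f"
  shows "(\<lambda>t. abel_kernel \<alpha> s t * f t) integrable_on {0..1}"
proof -
  have "abel_kernel \<alpha> s absolutely_integrable_on {0..1}"
    using abel_kernel_has_integral abel_kernel_nonneg
    by (intro nonnegative_absolutely_integrable_1) (auto simp: integrable_on_def)
  moreover have "bounded (f ` {0..1})"
    using assms by (intro compact_imp_bounded compact_continuous_image) auto
  ultimately have "(\<lambda>t. f t * abel_kernel \<alpha> s t) absolutely_integrable_on {0..1}"
    using assms
    by (intro absolutely_integrable_bounded_measurable_product_real
          continuous_imp_measurable_on_sets_lebesgue) auto
  then show ?thesis
    using set_lebesgue_integral_eq_integral(1) by (simp add: mult.commute)
qed

lemma moment_has_integral: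
  "continuous_on {0..1} f \<Longrightarrow> ((\<lambda>t. abel_kernel \<alpha> s t * f t) has_integral moment \<alpha> s f) {0..1}"
  using abel_kernel_mult_integrable by (simp add: moment_def integrable_integral)

lemma moment_const: "moment \<alpha> s (\<lambda>_. c) = weight \<alpha> s * c"
  unfolding moment_def by (intro integral_unique has_integral_mult_left abel_kernel_has_integral)

lemma moment_diff:
  assumes "continuous_on {0..1} f" "continuous_on {0..1} g"
  shows "moment \<alpha> s (\<lambda>t. f t - g t) = moment \<alpha> s f - moment \<alpha> s g"
  using integral_diff[OF assms[THEN abel_kernel_mult_integrable]]
  by (simp add: moment_def algebra_simps)

lemma moment_cmult: "moment \<alpha> s (\<lambda>t. c * f t) = c * moment \<alpha> s f"
  unfolding moment_def by (subst integral_mult_right[symmetric]) (simp add: algebra_simps)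

lemma moment_abs_le:
  assumes "continuous_on {0..1} f" "\<And>t. t \<in> {0..1} \<Longrightarrow> \<bar>f t\<bar> \<le> M"
  shows "\<bar>moment \<alpha> s f\<bar> \<le> weight \<alpha> s * M"
proof -
  have "norm (moment \<alpha> s f) \<le> weight \<alpha> s * M"
  proof (rule integral_norm_bound_integral[of "\<lambda>t. abel_kernel \<alpha> s t * f t" "{0..1}"
        "\<lambda>t. abel_kernel \<alpha> s t * M", folded moment_def, unfolded moment_const])
    show "norm (abel_kernel \<alpha> s t * f t) \<le> abel_kernel \<alpha> s t * M" if "t \<in> {0..1}" for t
      using assms(2)[OF that] abel_kernel_nonneg by (simp add: abs_mult mult_left_mono)
  qed (auto intro: abel_kernel_mult_integrable assms)
  then show ?thesis by simp
qed

lemma weight_0: "weight \<alpha> 0 = 1"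
  using \<alpha> by (simp add: weight_def)

lemma weight_pos: "0 < weight \<alpha> s"
  using \<alpha> by (simp add: weight_def powr_less_mono2)

text \<open>The quotient of consecutive kernels at \<open>t\<close> is increasing in \<open>s + t\<close>, so that its value at
  \<open>s + t = s + 1\<close> separates the quotients of consecutive weights.\<close>
lemma weight_log_convex:
  "weight \<alpha> (Suc s) * weight \<alpha> (Suc s) \<le> weight \<alpha> s * weight \<alpha> (Suc (Suc s))"
proof -
  define \<rho> where "\<rho> = ((real s + 2) / (real s + 1)) powr (\<alpha> - 1)"
  have quot: "abel_kernel \<alpha> (Suc n) t = abel_kernel \<alpha> n t * ((real n + t + 1) / (real n + t)) powr (\<alpha> - 1)"
    if "0 < real n + t" for n t
    using that by (simp add: abel_kernel_def powr_divide algebra_simps)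
  have le: "weight \<alpha> (Suc s) \<le> weight \<alpha> s * \<rho>"
  proof (rule has_integral_le[of _ _ "{0<..1}"])
    show "(abel_kernel \<alpha> (Suc s) has_integral weight \<alpha> (Suc s)) {0<..1}"
      using abel_kernel_has_integral[of "Suc s"] by (rule has_integral_half_open)
    have "((\<lambda>t. abel_kernel \<alpha> s t * \<rho>) has_integral weight \<alpha> s * \<rho>) {0..1}"
      by (intro has_integral_mult_left abel_kernel_has_integral)
    then show "((\<lambda>t. abel_kernel \<alpha> s t * \<rho>) has_integral weight \<alpha> s * \<rho>) {0<..1}" by (rule has_integral_half_open)
    show "abel_kernel \<alpha> (Suc s) t \<le> abel_kernel \<alpha> s t * \<rho>" if t: "t \<in> {0<..1}" for t
    proof -
      have "((real s + t + 1) / (real s + t)) powr (\<alpha> - 1) \<le> \<rho>"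
        unfolding \<rho>_def
        using t \<alpha> by (intro powr_mono2') (auto simp: field_simps)
      then show ?thesis
        using quot[of s t] t by (simp add: mult_left_mono abel_kernel_nonneg)
    qed
  qed
  have ge: "weight \<alpha> (Suc s) * \<rho> \<le> weight \<alpha> (Suc (Suc s))"
  proof (rule has_integral_le[of _ _ "{0..1}"])
    show "((\<lambda>t. abel_kernel \<alpha> (Suc s) t * \<rho>) has_integral weight \<alpha> (Suc s) * \<rho>) {0..1}"
      by (intro has_integral_mult_left abel_kernel_has_integral)
    show "abel_kernel \<alpha> (Suc s) t * \<rho> \<le> abel_kernel \<alpha> (Suc (Suc s)) t" if t: "t \<in> {0..1}" for t
    proof -
      have "\<rho> \<le> ((real (Suc s) + t + 1) / (real (Suc s) + t)) powr (\<alpha> - 1)"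
        unfolding \<rho>_def
        using t \<alpha> by (intro powr_mono2') (auto simp: field_simps)
      then show ?thesis
        using quot[of "Suc s" t] t by (simp add: mult_left_mono abel_kernel_nonneg)
    qed
  qed (rule abel_kernel_has_integral)
  have "weight \<alpha> (Suc s) * weight \<alpha> (Suc s) \<le> weight \<alpha> (Suc s) * (weight \<alpha> s * \<rho>)"
    by (intro mult_left_mono le less_imp_le weight_pos)
  also have "\<dots> \<le> weight \<alpha> s * weight \<alpha> (Suc (Suc s))"
    using mult_left_mono[OF ge less_imp_le[OF weight_pos[of s]]] by (simp add: algebra_simps)
  finally show ?thesis .
qed

lemma abel_kernel_Suc_le:
  assumes "0 < real s + t"
  shows "abel_kernel \<alpha> (Suc s) t \<le> abel_kernel \<alpha> s t"
  using abel_kernel_antimono[of s t "t + 1"] assms by (simp add: abel_kernel_Suc)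

lemma weight_Suc_le: "weight \<alpha> (Suc s) \<le> weight \<alpha> s"
proof (rule has_integral_le[of _ _ "{0<..1}"])
  show "(abel_kernel \<alpha> (Suc s) has_integral weight \<alpha> (Suc s)) {0<..1}"
    "(abel_kernel \<alpha> s has_integral weight \<alpha> s) {0<..1}"
    by (intro has_integral_half_open abel_kernel_has_integral)+
  show "abel_kernel \<alpha> (Suc s) t \<le> abel_kernel \<alpha> s t" if "t \<in> {0<..1}" for t
    using that by (intro abel_kernel_Suc_le) auto
qed

lemma weight_antimono: "m \<le> n \<Longrightarrow> weight \<alpha> n \<le> weight \<alpha> m"
  using lift_Suc_antimono_le[of "weight \<alpha>"] weight_Suc_le by blast

text \<open>This is \<open>1 - x powr (1 - \<alpha>) \<le> 1 - x\<close> for \<open>x = (s + t) / (s + 1 + t)\<close>.\<close>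
lemma abel_kernel_diff_le:
  assumes "0 < real s + t" "0 \<le> t"
  shows "real (Suc s) * (abel_kernel \<alpha> s t - abel_kernel \<alpha> (Suc s) t) \<le> abel_kernel \<alpha> s t"
proof -
  define x where "x = (real s + t) / (real s + t + 1)"
  have x: "0 < x" "x \<le> 1"
    using assms by (auto simp: x_def field_simps)
  have "abel_kernel \<alpha> (Suc s) t = abel_kernel \<alpha> s t * x powr (1 - \<alpha>)"
  proof -
    have "x powr (1 - \<alpha>) = ((real s + t + 1) / (real s + t)) powr (\<alpha> - 1)"
      using assms by (simp add: x_def powr_divide powr_diff field_simps)
    then show ?thesis
      using assms by (simp add: abel_kernel_def powr_divide algebra_simps)
  qed
  moreover have "x \<le> x powr (1 - \<alpha>)"
    using powr_mono'[of "1 - \<alpha>" 1 x] x \<alpha> by simp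
  moreover have "real (Suc s) * (1 - x) \<le> 1"
    using assms by (simp add: x_def field_simps)
  ultimately show ?thesis
  proof -
    assume k: "abel_kernel \<alpha> (Suc s) t = abel_kernel \<alpha> s t * x powr (1 - \<alpha>)"
      and xp: "x \<le> x powr (1 - \<alpha>)" and s: "real (Suc s) * (1 - x) \<le> 1"
    have "real (Suc s) * (1 - x powr (1 - \<alpha>)) \<le> real (Suc s) * (1 - x)"
      using xp by (intro mult_left_mono) auto
    then have "real (Suc s) * (1 - x powr (1 - \<alpha>)) \<le> 1"
      using s by linarith
    from mult_left_mono[OF this abel_kernel_nonneg[of s t]] show ?thesis
      by (simp add: k algebra_simps)
  qed
qed

text \<open>The pointwise kernel estimate, integrated. The gain of a factor \<open>Suc s\<close>
  will pay for functions that vanish on the diagonal and grow linearly with the distance from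
  it.\<close>

lemma weight_diff_le: "real (Suc s) * (weight \<alpha> s - weight \<alpha> (Suc s)) \<le> weight \<alpha> s"
proof (rule has_integral_le[of _ _ "{0<..1}"])
  have *: "(abel_kernel \<alpha> n has_integral weight \<alpha> n) {0<..1}" for n
    using abel_kernel_has_integral by (rule has_integral_half_open)
  show "((\<lambda>t. real (Suc s) * (abel_kernel \<alpha> s t - abel_kernel \<alpha> (Suc s) t)) has_integral
      real (Suc s) * (weight \<alpha> s - weight \<alpha> (Suc s))) {0<..1}"
    by (intro has_integral_mult_right has_integral_diff *)
  show "(abel_kernel \<alpha> s has_integral weight \<alpha> s) {0<..1}"
    by (rule *)
  show "real (Suc s) * (abel_kernel \<alpha> s t - abel_kernel \<alpha> (Suc s) t) \<le> abel_kernel \<alpha> s t"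
    if "t \<in> {0<..1}" for t
    using that by (intro abel_kernel_diff_le) auto
qed

text \<open>The kernel difference has constant sign on the half-open cell, so M comes out of the
  integral and the kernels integrate to their weights.\<close>

lemma moment_Suc_diff_le:
  assumes cont: "continuous_on {0..1} f" and bd: "\<And>t. t \<in> {0..1} \<Longrightarrow> \<bar>f t\<bar> \<le> M"
  shows "\<bar>moment \<alpha> (Suc s) f - moment \<alpha> s f\<bar> \<le> (weight \<alpha> s - weight \<alpha> (Suc s)) * M"
proof -
  let ?S = "{0<..1::real}"
  have *: "((\<lambda>t. abel_kernel \<alpha> n t * g t) has_integral moment \<alpha> n g) ?S"
    if "continuous_on {0..1} g" for n g
    using moment_has_integral[OF that] by (rule has_integral_half_open)
  have d: "((\<lambda>t. abel_kernel \<alpha> (Suc s) t * f t - abel_kernel \<alpha> s t * f t) has_integral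
      moment \<alpha> (Suc s) f - moment \<alpha> s f) ?S"
    by (intro has_integral_diff * cont)
  have b: "((\<lambda>t. abel_kernel \<alpha> s t * M - abel_kernel \<alpha> (Suc s) t * M) has_integral
      (weight \<alpha> s - weight \<alpha> (Suc s)) * M) ?S"
    using has_integral_diff[OF *[of "\<lambda>_. M" s] *[of "\<lambda>_. M" "Suc s"]]
    by (simp add: moment_const algebra_simps)
  have "norm (integral ?S (\<lambda>t. abel_kernel \<alpha> (Suc s) t * f t - abel_kernel \<alpha> s t * f t))
      \<le> integral ?S (\<lambda>t. abel_kernel \<alpha> s t * M - abel_kernel \<alpha> (Suc s) t * M)"
  proof (rule integral_norm_bound_integral)
    fix t assume t: "t \<in> ?S"
    have "\<bar>(abel_kernel \<alpha> (Suc s) t - abel_kernel \<alpha> s t) * f t\<bar>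
        = (abel_kernel \<alpha> s t - abel_kernel \<alpha> (Suc s) t) * \<bar>f t\<bar>"
      using abel_kernel_Suc_le[of s t] t by (simp add: abs_mult)
    also have "\<dots> \<le> (abel_kernel \<alpha> s t - abel_kernel \<alpha> (Suc s) t) * M"
      using abel_kernel_Suc_le[of s t] t bd[of t] by (intro mult_left_mono) auto
    finally show "norm (abel_kernel \<alpha> (Suc s) t * f t - abel_kernel \<alpha> s t * f t)
        \<le> abel_kernel \<alpha> s t * M - abel_kernel \<alpha> (Suc s) t * M"
      by (simp add: algebra_simps)
  qed (use d b in \<open>auto simp: integrable_on_def\<close>)
  then show ?thesis
    using d b by (simp add: integral_unique)
qed

end

section \<open>Inverse weights\<close>

lemma conv_cong: "(\<And>i. i \<le> s \<Longrightarrow> q i = r i) \<Longrightarrow> conv p q s = conv p r s"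
  by (simp add: conv_def)

lemma sum_diff_reindex: "(\<Sum>j=1..n. g (n - j)) = (\<Sum>s<n. g s)"
  for g :: "nat \<Rightarrow> real"
  by (rule sum.reindex_bij_witness[of _ "\<lambda>s. n - s" "\<lambda>j. n - j"]) auto

text \<open>The sequence is continued by 0 to the left, so entry 0 is \<open>q 0\<close> itself.
  This makes the operator multiplication by 1 - X and builds the boundary term of partial summation
  into it.\<close>

definition backward_diff :: "(nat \<Rightarrow> real) \<Rightarrow> nat \<Rightarrow> real" where
  "backward_diff q i = (if i = 0 then q 0 else q i - q (i - 1))"

lemma Abs_fps_backward_diff: "Abs_fps (backward_diff q) = (1 - fps_X) * Abs_fps q"
  by (rule fps_ext) (simp add: backward_diff_def algebra_simps)

lemma Abs_fps_conv: "Abs_fps (conv p q) = Abs_fps p * Abs_fps q"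
  by (rule fps_ext) (simp add: conv_fps)

lemma ones_times_one_minus_X: "Abs_fps (\<lambda>_. 1) * (1 - fps_X) = (1 :: real fps)"
  by (rule fps_ext) (simp add: algebra_simps)

text \<open>Bounds the oscillation of the kernel on cell s. Since
  \<open>abel_kernel \<alpha> s 1\<close> is the next kernel at 0, the entries with s > 0 telescope
  to at most \<alpha>. On cell 0 the kernel is unbounded; there 2 covers the moment and the mean,
  each at most the bound of the function.\<close>

definition moment_defect :: "real \<Rightarrow> nat \<Rightarrow> real" where
  "moment_defect \<alpha> s = (if s = 0 then 2 else abel_kernel \<alpha> s 0 - abel_kernel \<alpha> s 1)"

section \<open>Signs, sums and decay of the reciprocal coefficients\<close>

context
  fixes \<alpha> :: real
  assumes \<alpha>: "0 < \<alpha>" "\<alpha> < 1"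
begin

lemma Abs_fps_weight_inv: "Abs_fps (weight_inv \<alpha>) * Abs_fps (weight \<alpha>) = 1"
proof -
  have "Abs_fps (weight_inv \<alpha>) = inverse (Abs_fps (weight \<alpha>))"
    by (simp add: weight_inv_def fps_nth_inverse)
  then show ?thesis
    using weight_0[OF \<alpha>] by (simp add: inverse_mult_eq_1)
qed

lemma Abs_fps_weight_inv_sum:
  "Abs_fps (weight_inv_sum \<alpha>) = Abs_fps (weight_inv \<alpha>) * Abs_fps (\<lambda>_. 1)"
  by (rule fps_ext) (simp add: weight_inv_sum_def fps_mult_nth atLeast0AtMost)

lemma conv_weight_inv_weight: "conv (weight_inv \<alpha>) (weight \<alpha>) s = (if s = 0 then 1 else 0)"
  by (simp add: conv_fps Abs_fps_weight_inv)

lemma conv_weight_inv_sum_weight: "conv (weight_inv_sum \<alpha>) (weight \<alpha>) s = 1"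
proof -
  have "Abs_fps (weight_inv_sum \<alpha>) * Abs_fps (weight \<alpha>) = Abs_fps (\<lambda>_. 1)"
    using Abs_fps_weight_inv by (simp add: Abs_fps_weight_inv_sum mult.commute mult.left_commute)
  then show ?thesis
    by (simp add: conv_fps)
qed

text \<open>Abel summation: the factor 1 = (1 / (1 - X)) (1 - X) is inserted between the two series,
  one half going to each side.\<close>

lemma conv_by_parts:
  "conv (weight_inv \<alpha>) q s = conv (weight_inv_sum \<alpha>) (backward_diff q) s"
proof -
  have "Abs_fps (weight_inv_sum \<alpha>) * Abs_fps (backward_diff q)
      = Abs_fps (weight_inv \<alpha>) * (Abs_fps (\<lambda>_. 1) * (1 - fps_X)) * Abs_fps q"
    by (simp only: Abs_fps_backward_diff Abs_fps_weight_inv_sum mult.assoc)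
  then show ?thesis
    by (simp add: conv_fps ones_times_one_minus_X)
qed

lemma weight_inv_0: "weight_inv \<alpha> 0 = 1"
  using weight_0[OF \<alpha>] by (simp add: weight_inv_def)

lemma weight_inv_nonpos: "0 < n \<Longrightarrow> weight_inv \<alpha> n \<le> 0"
  unfolding weight_inv_def
  by (rule kaluza) (auto simp: \<alpha> weight_pos weight_0 weight_log_convex)

text \<open>For n > 0 the convolution with the weights is 0. The weights decrease and all
  coefficients but the first are nonpositive, so replacing every weight by
  \<open>weight \<alpha> n\<close> can only raise it, to
  \<open>weight_inv_sum \<alpha> n * weight \<alpha> n\<close>.\<close>

lemma weight_inv_sum_nonneg: "0 \<le> weight_inv_sum \<alpha> n"
proof (cases "n = 0")
  case False
  have "0 = (\<Sum>i\<le>n. weight_inv \<alpha> (n - i) * weight \<alpha> i)"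
    using conv_weight_inv_weight[of n] False by (simp add: conv_def)
  also have "\<dots> \<le> (\<Sum>i\<le>n. weight_inv \<alpha> (n - i) * weight \<alpha> n)"
  proof (rule sum_mono)
    fix i assume "i \<in> {..n}"
    then show "weight_inv \<alpha> (n - i) * weight \<alpha> i \<le> weight_inv \<alpha> (n - i) * weight \<alpha> n"
      using weight_antimono[OF \<alpha>, of i n] weight_inv_nonpos[of "n - i"]
      by (cases "i = n") (auto intro: mult_left_mono_neg)
  qed
  also have "\<dots> = weight_inv_sum \<alpha> n * weight \<alpha> n"
    unfolding weight_inv_sum_def sum_distrib_right[symmetric]
    by (simp add: sum.nat_diff_reindex[of _ "Suc n", simplified lessThan_Suc_atMost, simplified])
  finally show ?thesis
    using weight_pos[OF \<alpha>, of n] by (simp add: zero_le_mult_iff)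
qed (simp add: weight_inv_sum_def weight_inv_0)

text \<open>Only the coefficient at 0, which is 1, is positive; the sum of absolute values is thus 2
  minus a nonnegative partial sum.\<close>

lemma sum_abs_weight_inv: "(\<Sum>i<n. \<bar>weight_inv \<alpha> i\<bar>) \<le> 2"
proof (cases n)
  case (Suc m)
  have "(\<Sum>i<n. \<bar>weight_inv \<alpha> i\<bar>) = 1 + (\<Sum>i<m. \<bar>weight_inv \<alpha> (Suc i)\<bar>)"
    by (simp only: Suc sum.lessThan_Suc_shift) (simp add: weight_inv_0)
  also have "(\<Sum>i<m. \<bar>weight_inv \<alpha> (Suc i)\<bar>) = - (\<Sum>i<m. weight_inv \<alpha> (Suc i))"
    by (simp add: sum_negf[symmetric] abs_of_nonpos weight_inv_nonpos)
  also have "(\<Sum>i<m. weight_inv \<alpha> (Suc i)) = weight_inv_sum \<alpha> m - 1"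
    by (simp only: weight_inv_sum_def lessThan_Suc_atMost[symmetric] sum.lessThan_Suc_shift)
       (simp add: weight_inv_0)
  finally show ?thesis
    using weight_inv_sum_nonneg[of m] by simp
qed simp

text \<open>The partial sums decrease, so their convolution with the weights, which is 1, is at
  least the last partial sum times the total weight, and the weights telescope to
  \<open>(real n + 1) powr \<alpha>\<close>.\<close>

lemma weight_inv_sum_le: "weight_inv_sum \<alpha> n \<le> (real n + 1) powr - \<alpha>"
proof -
  have anti: "weight_inv_sum \<alpha> n \<le> weight_inv_sum \<alpha> m" if "m \<le> n" for m
    using lift_Suc_antimono_le[of "weight_inv_sum \<alpha>" m n] that
    by (simp add: weight_inv_sum_def weight_inv_nonpos)
  have tel: "(\<Sum>i\<le>n. weight \<alpha> i) = (real n + 1) powr \<alpha>"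
    using \<alpha> by (induction n) (auto simp: weight_def algebra_simps)
  have "weight_inv_sum \<alpha> n * (real n + 1) powr \<alpha> = (\<Sum>i\<le>n. weight_inv_sum \<alpha> n * weight \<alpha> i)"
    by (simp add: tel[symmetric] sum_distrib_left)
  also have "\<dots> \<le> conv (weight_inv_sum \<alpha>) (weight \<alpha>) n"
    unfolding conv_def
    by (intro sum_mono mult_right_mono anti less_imp_le[OF weight_pos] \<alpha>) auto
  finally show ?thesis
    using conv_weight_inv_sum_weight[of n]
    by (simp add: powr_minus field_simps)
qed

lemma weight_inv_sum_le_1: "weight_inv_sum \<alpha> n \<le> 1"
proof -
  have "(real n + 1) powr - \<alpha> \<le> 1 powr - \<alpha>"
    using \<alpha> by (intro powr_mono2') auto
  then show ?thesis
    using weight_inv_sum_le[of n] by simp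
qed

text \<open>After partial summation the increments meet \<open>weight_inv_sum\<close>, whose
  convolution with the weights is constantly 1. The bound therefore does not grow with s.\<close>

lemma conv_weight_inv_le:
  assumes q0: "q 0 = 0" and q: "\<And>i. i < s \<Longrightarrow> \<bar>q (Suc i) - q i\<bar> \<le> \<eta> * weight \<alpha> i"
    and "0 \<le> \<eta>"
  shows "\<bar>conv (weight_inv \<alpha>) q s\<bar> \<le> \<eta>"
proof (cases s)
  case 0
  with assms show ?thesis by (simp add: conv_def)
next
  case (Suc m)
  have "\<bar>conv (weight_inv \<alpha>) q s\<bar>
      \<le> conv (weight_inv_sum \<alpha>) (\<lambda>i. if i = 0 then 0 else \<eta> * weight \<alpha> (i - 1)) s"
    unfolding conv_by_parts
  proof (rule conv_mono)
    show "\<bar>backward_diff q i\<bar> \<le> (if i = 0 then 0 else \<eta> * weight \<alpha> (i - 1))" if "i \<le> s" for i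
      using q[of "i - 1"] q0 that by (cases i) (auto simp: backward_diff_def)
  qed (rule weight_inv_sum_nonneg)
  also have "\<dots> = conv (weight_inv_sum \<alpha>) (\<lambda>i. \<eta> * weight \<alpha> i) m"
    by (simp add: conv_def Suc sum.atMost_Suc_shift del: sum.atMost_Suc)
  also have "\<dots> = \<eta>"
    by (simp add: conv_cmult conv_weight_inv_sum_weight)
  finally show ?thesis .
qed

text \<open>An increment of the moments has two sources: the change of kernel, where the linear
  growth of \<open>G\<close> is absorbed by \<open>weight_diff_le\<close>, and the change of
  \<open>G\<close> itself. Each is at most \<eta> times a weight, whence the factor 2.\<close>

lemma conv_moment_increments_le:
  assumes cont: "\<And>i. i \<le> s \<Longrightarrow> continuous_on {0..1} (G i)"
    and G0: "\<And>t. t \<in> {0..1} \<Longrightarrow> G 0 t = 0"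
    and G: "\<And>i t. i < s \<Longrightarrow> t \<in> {0..1} \<Longrightarrow> \<bar>G (Suc i) t - G i t\<bar> \<le> \<eta>"
    and "0 \<le> \<eta>"
  shows "\<bar>conv (weight_inv \<alpha>) (\<lambda>i. moment \<alpha> i (G i)) s\<bar> \<le> 2 * \<eta>"
proof (rule conv_weight_inv_le)
  show "moment \<alpha> 0 (G 0) = 0"
    using moment_abs_le[OF \<alpha>, of "G 0" 0 0] cont[of 0] G0 by simp
  show "\<bar>moment \<alpha> (Suc i) (G (Suc i)) - moment \<alpha> i (G i)\<bar> \<le> 2 * \<eta> * weight \<alpha> i"
    if i: "i < s" for i
  proof -
    have le: "\<bar>G m t\<bar> \<le> real m * \<eta>" if "m \<le> s" "t \<in> {0..1}" for m t
      using that
    proof (induction m)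
      case (Suc m)
      then show ?case
        using G[of m t] by (simp add: algebra_simps)
    qed (simp add: G0)
    have c: "continuous_on {0..1} (G (Suc i))" "continuous_on {0..1} (G i)"
      using cont i by auto
    have "\<bar>moment \<alpha> (Suc i) (G (Suc i)) - moment \<alpha> i (G (Suc i))\<bar>
        \<le> (weight \<alpha> i - weight \<alpha> (Suc i)) * (real (Suc i) * \<eta>)"
      using i by (intro moment_Suc_diff_le \<alpha> c le) auto
    also have "\<dots> \<le> \<eta> * weight \<alpha> i"
      using mult_right_mono[OF weight_diff_le[OF \<alpha>, of i] \<open>0 \<le> \<eta>\<close>] by (simp add: algebra_simps)
    finally have 1: "\<bar>moment \<alpha> (Suc i) (G (Suc i)) - moment \<alpha> i (G (Suc i))\<bar> \<le> \<eta> * weight \<alpha> i" .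
    have "\<bar>moment \<alpha> i (\<lambda>t. G (Suc i) t - G i t)\<bar> \<le> weight \<alpha> i * \<eta>"
      using i by (intro moment_abs_le \<alpha> continuous_intros c G) auto
    then have 2: "\<bar>moment \<alpha> i (G (Suc i)) - moment \<alpha> i (G i)\<bar> \<le> \<eta> * weight \<alpha> i"
      by (simp add: moment_diff[OF \<alpha> c] mult.commute)
    show ?thesis
      using 1 2 by (simp add: algebra_simps)
  qed
qed (use \<open>0 \<le> \<eta>\<close> in auto)

lemma moment_defect_nonneg: "0 \<le> moment_defect \<alpha> s"
  using abel_kernel_antimono[OF \<alpha>, of s 0 1] by (simp add: moment_defect_def)

lemma sum_moment_defect: "(\<Sum>i<n. moment_defect \<alpha> i) \<le> 3"
proof (cases n)
  case (Suc m)
  have "(\<Sum>i<m. moment_defect \<alpha> (Suc i)) = abel_kernel \<alpha> 1 0 - abel_kernel \<alpha> (Suc m) 0"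
    by (induction m) (auto simp: moment_defect_def abel_kernel_Suc[OF \<alpha>, of "Suc _" 0])
  also have "\<dots> \<le> 1"
    using abel_kernel_nonneg[OF \<alpha>, of "Suc m" 0] \<alpha> by (simp add: abel_kernel_def[of _ "Suc 0"])
  finally have "(\<Sum>i<m. moment_defect \<alpha> (Suc i)) \<le> 1" .
  then show ?thesis
    unfolding Suc sum.lessThan_Suc_shift by (simp add: moment_defect_def)
qed simp

text \<open>For s > 0 the kernel and its mean \<open>weight \<alpha> s\<close> both lie between the
  kernel's values at the ends of the cell. For s = 0 the two terms are estimated separately.\<close>

lemma moment_mean_diff_le:
  assumes cont: "continuous_on {0..1} f" and bd: "\<And>t. t \<in> {0..1} \<Longrightarrow> \<bar>f t\<bar> \<le> M"
  shows "\<bar>moment \<alpha> s f - weight \<alpha> s * integral {0..1} f\<bar> \<le> moment_defect \<alpha> s * M"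
proof -
  have int: "f integrable_on {0..1}"
    using cont by (rule integrable_continuous_real)
  show ?thesis
  proof (cases "s = 0")
    case True
    have "norm (integral {0..1} f) \<le> integral {0..1} (\<lambda>_::real. M)"
      using bd by (intro integral_norm_bound_integral int) auto
    then show ?thesis
      using moment_abs_le[OF \<alpha> cont bd, of 0] True
      by (simp add: weight_0[OF \<alpha>] moment_defect_def)
  next
    case False
    let ?b = "abel_kernel \<alpha> s"
    have ends: "?b 1 \<le> ?b t" "?b t \<le> ?b 0" if "t \<in> {0..1}" for t
      using that False by (auto intro!: abel_kernel_antimono[OF \<alpha>])
    have b0: "((\<lambda>_. ?b 0) has_integral ?b 0) {0..1::real}" "((\<lambda>_. ?b 1) has_integral ?b 1) {0..1::real}"
      using has_integral_const_real[of "?b 0" 0 1] has_integral_const_real[of "?b 1" 0 1] by simp_all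
    have w: "?b 1 \<le> weight \<alpha> s" "weight \<alpha> s \<le> ?b 0"
      using ends by (auto intro: has_integral_le[OF b0(2) abel_kernel_has_integral[OF \<alpha>]]
          has_integral_le[OF abel_kernel_has_integral[OF \<alpha>] b0(1)])
    have d: "((\<lambda>t. ?b t * f t - weight \<alpha> s * f t) has_integral
        moment \<alpha> s f - weight \<alpha> s * integral {0..1} f) {0..1}"
      by (intro has_integral_diff moment_has_integral \<alpha> cont has_integral_mult_right
            integrable_integral int)
    have "norm (integral {0..1} (\<lambda>t. ?b t * f t - weight \<alpha> s * f t))
        \<le> integral {0..1} (\<lambda>_::real. (?b 0 - ?b 1) * M)"
    proof (rule integral_norm_bound_integral)
      fix t :: real assume t: "t \<in> {0..1}"
      have "\<bar>(?b t - weight \<alpha> s) * f t\<bar> \<le> (?b 0 - ?b 1) * M"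
        unfolding abs_mult
        using ends[OF t] w bd[OF t] by (intro mult_mono) auto
      then show "norm (?b t * f t - weight \<alpha> s * f t) \<le> (?b 0 - ?b 1) * M"
        by (simp add: algebra_simps)
    qed (use d in \<open>auto simp: integrable_on_def\<close>)
    then show ?thesis
      using d False by (simp add: integral_unique moment_defect_def)
  qed
qed

text \<open>Column j is split into three parts. The mean of \<open>F j j\<close> multiplies the
  weights, so the inverse annihilates it except for j = n, leaving \<epsilon>. The deviation of the
  kernel from its mean gives at most 2 * 3 = 6 times \<epsilon> over all columns, as a convolution
  of summable sequences. The drift of \<open>F\<close> away from the diagonal gives 2 h \<epsilon>
  in each of n columns.\<close>

lemma sum_conv_moment_le:
  assumes cont: "\<And>m j. 1 \<le> j \<Longrightarrow> j \<le> m \<Longrightarrow> m \<le> n \<Longrightarrow> continuous_on {0..1} (F m j)"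
    and diag: "\<And>j t. 1 \<le> j \<Longrightarrow> j \<le> n \<Longrightarrow> t \<in> {0..1} \<Longrightarrow> \<bar>F j j t\<bar> \<le> \<epsilon>"
    and incr: "\<And>m j t. 1 \<le> j \<Longrightarrow> j \<le> m \<Longrightarrow> m < n \<Longrightarrow> t \<in> {0..1} \<Longrightarrow>
      \<bar>F (Suc m) j t - F m j t\<bar> \<le> h * \<epsilon>"
    and "0 \<le> \<epsilon>" "0 \<le> h"
  shows "\<bar>\<Sum>j=1..n. conv (weight_inv \<alpha>) (\<lambda>i. moment \<alpha> i (F (j + i) j)) (n - j)\<bar>
    \<le> (7 + 2 * real n * h) * \<epsilon>"
proof -
  have each: "\<bar>conv (weight_inv \<alpha>) (\<lambda>i. moment \<alpha> i (F (j + i) j)) (n - j)\<bar>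
      \<le> (if n = j then \<epsilon> else 0)
        + \<epsilon> * conv (\<lambda>i. \<bar>weight_inv \<alpha> i\<bar>) (moment_defect \<alpha>) (n - j) + 2 * (h * \<epsilon>)"
    if j: "j \<in> {1..n}" for j
  proof -
    let ?f = "F j j"
    define \<mu> where "\<mu> = integral {0..1} ?f"
    have cf: "continuous_on {0..1} ?f"
      using cont j by auto
    have bf: "\<bar>?f t\<bar> \<le> \<epsilon>" if "t \<in> {0..1}" for t
      using diag j that by auto
    have "norm \<mu> \<le> integral {0..1} (\<lambda>_::real. \<epsilon>)"
      unfolding \<mu>_def using bf
      by (intro integral_norm_bound_integral integrable_continuous_real cf) auto
    then have \<mu>: "\<bar>\<mu>\<bar> \<le> \<epsilon>" by simp
    have "conv (weight_inv \<alpha>) (\<lambda>i. moment \<alpha> i (F (j + i) j)) (n - j)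
        = conv (weight_inv \<alpha>) (\<lambda>i. (\<mu> * weight \<alpha> i + (moment \<alpha> i ?f - weight \<alpha> i * \<mu>))
            + moment \<alpha> i (\<lambda>t. F (j + i) j t - ?f t)) (n - j)"
      using j by (intro conv_cong) (subst moment_diff; auto intro: \<alpha> cont)
    also have "\<dots> = \<mu> * (if n = j then 1 else 0)
        + conv (weight_inv \<alpha>) (\<lambda>i. moment \<alpha> i ?f - weight \<alpha> i * \<mu>) (n - j)
        + conv (weight_inv \<alpha>) (\<lambda>i. moment \<alpha> i (\<lambda>t. F (j + i) j t - ?f t)) (n - j)"
      using j by (simp only: conv_add conv_cmult conv_weight_inv_weight) auto
    finally have eq: "conv (weight_inv \<alpha>) (\<lambda>i. moment \<alpha> i (F (j + i) j)) (n - j) = \<dots>" .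
    have "\<bar>conv (weight_inv \<alpha>) (\<lambda>i. moment \<alpha> i ?f - weight \<alpha> i * \<mu>) (n - j)\<bar>
        \<le> conv (\<lambda>i. \<bar>weight_inv \<alpha> i\<bar>) (\<lambda>i. \<epsilon> * moment_defect \<alpha> i) (n - j)"
      unfolding \<mu>_def
      by (rule conv_abs_le) (use moment_mean_diff_le[OF cf bf] in \<open>simp add: mult.commute\<close>)
    moreover have "\<bar>conv (weight_inv \<alpha>) (\<lambda>i. moment \<alpha> i (\<lambda>t. F (j + i) j t - ?f t)) (n - j)\<bar>
        \<le> 2 * (h * \<epsilon>)"
      using j \<open>0 \<le> \<epsilon>\<close> \<open>0 \<le> h\<close>
      by (intro conv_moment_increments_le) (auto intro!: continuous_intros cont cf incr)
    ultimately show ?thesis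
      unfolding eq conv_cmult using \<mu> by (cases "n = j"; simp only: if_True if_False; argo)
  qed
  have "\<bar>\<Sum>j=1..n. conv (weight_inv \<alpha>) (\<lambda>i. moment \<alpha> i (F (j + i) j)) (n - j)\<bar>
      \<le> (\<Sum>j=1..n. (if n = j then \<epsilon> else 0)
        + \<epsilon> * conv (\<lambda>i. \<bar>weight_inv \<alpha> i\<bar>) (moment_defect \<alpha>) (n - j) + 2 * (h * \<epsilon>))"
    by (rule order_trans[OF sum_abs]) (rule sum_mono, rule each)
  also have "\<dots> = (\<Sum>j=1..n. if n = j then \<epsilon> else 0)
      + \<epsilon> * (\<Sum>j=1..n. conv (\<lambda>i. \<bar>weight_inv \<alpha> i\<bar>) (moment_defect \<alpha>) (n - j)) + real n * (2 * (h * \<epsilon>))"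
    by (simp add: sum.distrib sum_distrib_left)
  also have "\<dots> \<le> \<epsilon> + \<epsilon> * 6 + real n * (2 * (h * \<epsilon>))"
  proof -
    have "(\<Sum>j=1..n. if n = j then \<epsilon> else 0) \<le> \<epsilon>"
      using \<open>0 \<le> \<epsilon>\<close> by simp
    moreover have "(\<Sum>j=1..n. conv (\<lambda>i. \<bar>weight_inv \<alpha> i\<bar>) (moment_defect \<alpha>) (n - j)) \<le> 6"
    proof -
      have "(\<Sum>s<n. conv (\<lambda>i. \<bar>weight_inv \<alpha> i\<bar>) (moment_defect \<alpha>) s)
          \<le> (\<Sum>i<n. \<bar>weight_inv \<alpha> i\<bar>) * (\<Sum>i<n. moment_defect \<alpha> i)"
        by (rule sum_conv_le) (auto intro: moment_defect_nonneg)
      also have "\<dots> \<le> 2 * 3"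
        by (intro mult_mono sum_abs_weight_inv sum_moment_defect sum_nonneg moment_defect_nonneg) auto
      finally show ?thesis
        unfolding sum_diff_reindex by simp
    qed
    ultimately show ?thesis
      using \<open>0 \<le> \<epsilon>\<close> by (intro add_mono mult_left_mono order_refl) auto
  qed
  finally show ?thesis
    by (simp add: algebra_simps)
qed

end

text \<open>\<open>g\<close> need not be monotone at \<open>0\<close>, where \<open>abel_kernel \<alpha> 0\<close> has a junk value.\<close>
lemma integral_antimono_centered_nonneg:
  fixes g :: "real \<Rightarrow> real"
  assumes int: "((\<lambda>t. g t * (1/2 - t)) has_integral I) {0..1}"
    and anti: "\<And>s t. 0 < s \<Longrightarrow> s \<le> t \<Longrightarrow> t \<le> 1 \<Longrightarrow> g t \<le> g s"
  shows "0 \<le> I"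
proof -
  \<comment> \<open>Subtracting \<open>g (1/2)\<close> from \<open>g\<close> leaves the integral
    unchanged, as 1/2 - t has mean 0, and makes the integrand nonnegative: both factors change sign
    at 1/2.\<close>
  have "((\<lambda>t. g (1/2) * (t / 2 - t\<^sup>2 / 2)) has_vector_derivative g (1/2) * (1/2 - t)) (at t within {0..1})"
    for t
    unfolding has_real_derivative_iff_has_vector_derivative[symmetric]
    by (auto intro!: derivative_eq_intros simp: field_simps)
  then have "((\<lambda>t. g (1/2) * (1/2 - t)) has_integral
      (g (1/2) * (1 / 2 - 1\<^sup>2 / 2) - g (1/2) * (0 / 2 - 0\<^sup>2 / 2))) {0..1}"
    by (intro fundamental_theorem_of_calculus) auto
  then have "((\<lambda>t. g (1/2) * (1/2 - t)) has_integral 0) {0..1}"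
    by simp
  then have "((\<lambda>t. g t * (1/2 - t) - g (1/2) * (1/2 - t)) has_integral I - 0) {0<..1}"
    by (intro has_integral_half_open has_integral_diff int)
  moreover have "0 \<le> g t * (1/2 - t) - g (1/2) * (1/2 - t)" if "t \<in> {0<..1}" for t
  proof -
    have "0 \<le> (g t - g (1/2)) * (1/2 - t)"
      using anti[of t "1/2"] anti[of "1/2" t] that
      by (cases "t \<le> 1/2") (auto intro: mult_nonpos_nonpos)
    then show ?thesis by (simp add: algebra_simps)
  qed
  ultimately have "0 \<le> I - 0"
    by (rule has_integral_nonneg)
  then show ?thesis
    by simp
qed

text \<open>The displacement of y from the midpoint of its cell is h (1/2 - t), which fixes the
  sign.\<close>

definition centered_moment :: "real \<Rightarrow> nat \<Rightarrow> real" where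
  "centered_moment \<alpha> s = moment \<alpha> s (\<lambda>t. 1/2 - t)"

section \<open>Moments about the midpoint and partial summation\<close>

context
  fixes \<alpha> :: real
  assumes \<alpha>: "0 < \<alpha>" "\<alpha> < 1"
begin

lemma centered_moment_has_integral:
  "((\<lambda>t. abel_kernel \<alpha> s t * (1/2 - t)) has_integral centered_moment \<alpha> s) {0..1}"
  unfolding centered_moment_def by (intro moment_has_integral \<alpha> continuous_intros)

lemma centered_moment_nonneg: "0 \<le> centered_moment \<alpha> s"
  by (rule integral_antimono_centered_nonneg[OF centered_moment_has_integral])
     (auto intro: abel_kernel_antimono[OF \<alpha>])

text \<open>The kernel is convex in t, so the difference of consecutive kernels is again decreasing,
  and a decreasing function has a nonnegative moment against 1/2 - t.\<close>

lemma centered_moment_Suc_le: "centered_moment \<alpha> (Suc s) \<le> centered_moment \<alpha> s"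
proof -
  have "((\<lambda>t. (abel_kernel \<alpha> s t - abel_kernel \<alpha> (Suc s) t) * (1/2 - t)) has_integral
      centered_moment \<alpha> s - centered_moment \<alpha> (Suc s)) {0..1}"
    using has_integral_diff[OF centered_moment_has_integral centered_moment_has_integral]
    by (simp add: algebra_simps)
  then have "0 \<le> centered_moment \<alpha> s - centered_moment \<alpha> (Suc s)"
  proof (rule integral_antimono_centered_nonneg)
    fix x y :: real assume xy: "0 < x" "x \<le> y" "y \<le> 1"
    show "abel_kernel \<alpha> s y - abel_kernel \<alpha> (Suc s) y \<le> abel_kernel \<alpha> s x - abel_kernel \<alpha> (Suc s) x"
    proof (rule DERIV_nonpos_imp_nonincreasing[OF xy(2)])
      fix t assume t: "x \<le> t" "t \<le> y"
      let ?d = "\<alpha> * (\<alpha> - 1) * ((real s + t) powr (\<alpha> - 2) - (real s + 1 + t) powr (\<alpha> - 2))"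
      have "((\<lambda>t. abel_kernel \<alpha> s t - abel_kernel \<alpha> (Suc s) t) has_real_derivative ?d) (at t)"
        unfolding abel_kernel_def using xy t
        by (auto intro!: derivative_eq_intros simp: algebra_simps)
      moreover have "(real s + 1 + t) powr (\<alpha> - 2) \<le> (real s + t) powr (\<alpha> - 2)"
        using xy t \<alpha> by (intro powr_mono2') auto
      then have "?d \<le> 0"
        using \<alpha> by (intro mult_nonpos_nonneg mult_nonneg_nonpos) auto
      ultimately show "\<exists>d. ((\<lambda>t. abel_kernel \<alpha> s t - abel_kernel \<alpha> (Suc s) t) has_real_derivative d) (at t)
          \<and> d \<le> 0" by blast
    qed
  qed
  then show ?thesis by simp
qed

text \<open>As 1/2 - t has mean 0 and is bounded by 1/2, each moment is at most half a
  \<open>moment_defect\<close>, and those sum to at most 3.\<close>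

lemma sum_centered_moment: "(\<Sum>i<n. centered_moment \<alpha> i) \<le> 3 / 2"
proof -
  have "((\<lambda>t. t / 2 - t\<^sup>2 / 2) has_vector_derivative 1/2 - t) (at t within {0..1})" for t :: real
    unfolding has_real_derivative_iff_has_vector_derivative[symmetric]
    by (auto intro!: derivative_eq_intros simp: field_simps)
  then have "((\<lambda>t. 1/2 - t :: real) has_integral (1 / 2 - 1\<^sup>2 / 2) - (0 / 2 - 0\<^sup>2 / 2)) {0..1}"
    by (intro fundamental_theorem_of_calculus) auto
  then have int: "integral {0..1} (\<lambda>t. 1/2 - t :: real) = 0"
    by (simp add: integral_unique)
  have "centered_moment \<alpha> i \<le> moment_defect \<alpha> i * (1/2)" for i
  proof -
    have "\<bar>moment \<alpha> i (\<lambda>t. 1/2 - t) - weight \<alpha> i * integral {0..1} (\<lambda>t. 1/2 - t)\<bar>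
        \<le> moment_defect \<alpha> i * (1/2)"
      by (intro moment_mean_diff_le \<alpha> continuous_intros) (auto simp: abs_if)
    then show ?thesis
      by (simp add: int centered_moment_def)
  qed
  then have "(\<Sum>i<n. centered_moment \<alpha> i) \<le> (\<Sum>i<n. moment_defect \<alpha> i * (1/2))"
    by (intro sum_mono)
  also have "\<dots> \<le> 3 / 2"
    using sum_moment_defect[OF \<alpha>, of n] by (simp add: sum_divide_distrib[symmetric])
  finally show ?thesis .
qed

text \<open>Partial summation turns this into a sum of the moments themselves, less a nonnegative
  boundary term.\<close>

lemma sum_index_centered_moment_diff:
  "(\<Sum>i<n. real i * (centered_moment \<alpha> i - centered_moment \<alpha> (Suc i))) \<le> 3 / 2"
proof -
  have "(\<Sum>i<n. real i * (centered_moment \<alpha> i - centered_moment \<alpha> (Suc i))) + real n * centered_moment \<alpha> n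
      = (\<Sum>i<n. centered_moment \<alpha> (Suc i))"
    by (induction n) (auto simp: algebra_simps)
  also have "\<dots> = (\<Sum>i<Suc n. centered_moment \<alpha> i) - centered_moment \<alpha> 0"
    by (simp only: sum.lessThan_Suc_shift)
  also have "\<dots> \<le> 3 / 2"
    using sum_centered_moment[of "Suc n"] centered_moment_nonneg[of 0] by linarith
  finally show ?thesis
    using centered_moment_nonneg[of n] by (smt (verit) mult_nonneg_nonneg of_nat_0_le_iff)
qed

lemma sum_weight_inv_sum_nonneg: "0 \<le> (\<Sum>s<n. weight_inv_sum \<alpha> s)"
  by (intro sum_nonneg weight_inv_sum_nonneg \<alpha>)

text \<open>In the product of three series, 1 / (1 - X) is given to the inverse weights and 1 - X to
  \<open>P\<close>. The resulting \<open>S\<close> is bounded by 3/2, which handles the boundary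
  value \<open>P 1\<close>; the increments of \<open>P\<close> meet the sum of
  \<open>S\<close>.\<close>

lemma conv_centered_moment_diag_le:
  assumes n: "1 \<le> n" and P1: "\<bar>P 1\<bar> \<le> \<eta>\<^sub>1"
    and P: "\<And>j. 1 \<le> j \<Longrightarrow> j < n \<Longrightarrow> \<bar>P (Suc j) - P j\<bar> \<le> \<eta>" and "0 \<le> \<eta>"
  shows "\<bar>\<Sum>j=1..n. P j * conv (weight_inv \<alpha>) (centered_moment \<alpha>) (n - j)\<bar>
    \<le> 3 / 2 * \<eta>\<^sub>1 + 3 / 2 * \<eta> * (\<Sum>s<n. weight_inv_sum \<alpha> s)"
proof -
  obtain k where k: "n = Suc k"
    using n by (cases n) auto
  define S where "S = conv (weight_inv_sum \<alpha>) (centered_moment \<alpha>)"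
  \<comment> \<open>The shift turns a sum starting at j = 1 into a convolution; entry 0 of the
    backward difference of \<open>Q\<close> is then \<open>P 1\<close>.\<close>
  define Q where "Q i = P (Suc i)" for i
  have S0: "0 \<le> S i" for i
    unfolding S_def conv_def
    by (intro sum_nonneg mult_nonneg_nonneg weight_inv_sum_nonneg \<alpha> centered_moment_nonneg)
  have S1: "S i \<le> 3 / 2" for i
  proof -
    have "S i \<le> (\<Sum>m\<le>i. 1 * centered_moment \<alpha> m)"
      unfolding S_def conv_def
      by (intro sum_mono mult_right_mono weight_inv_sum_le_1 \<alpha> centered_moment_nonneg)
    then show ?thesis
      using sum_centered_moment[of "Suc i"] by (simp add: lessThan_Suc_atMost)
  qed
  have "(\<Sum>j=1..n. P j * conv (weight_inv \<alpha>) (centered_moment \<alpha>) (n - j))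
      = conv (conv (weight_inv \<alpha>) (centered_moment \<alpha>)) Q k"
    unfolding conv_def[of "conv _ _"]
    by (rule sum.reindex_bij_witness[of _ Suc "\<lambda>j. j - 1"]) (auto simp: k Q_def)
  also have "\<dots> = fps_nth (Abs_fps (weight_inv \<alpha>) * (Abs_fps (\<lambda>_. 1) * (1 - fps_X))
      * Abs_fps (centered_moment \<alpha>) * Abs_fps Q) k"
    by (simp add: conv_fps Abs_fps_conv ones_times_one_minus_X)
  also have "Abs_fps (weight_inv \<alpha>) * (Abs_fps (\<lambda>_. 1) * (1 - fps_X))
      * Abs_fps (centered_moment \<alpha>) * Abs_fps Q
      = (Abs_fps (weight_inv \<alpha>) * Abs_fps (\<lambda>_. 1) * Abs_fps (centered_moment \<alpha>))
        * ((1 - fps_X) * Abs_fps Q)"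
    by (simp only: mult_ac)
  also have "fps_nth \<dots> k = conv S (backward_diff Q) k"
    unfolding S_def conv_fps[of "conv _ _"] Abs_fps_conv Abs_fps_weight_inv_sum[OF \<alpha>]
      Abs_fps_backward_diff ..
  finally have eq: "(\<Sum>j=1..n. P j * conv (weight_inv \<alpha>) (centered_moment \<alpha>) (n - j))
      = conv S (backward_diff Q) k" .
  have "\<bar>conv S (backward_diff Q) k\<bar> \<le> conv S (\<lambda>i. if i = 0 then \<eta>\<^sub>1 else \<eta>) k"
  proof (rule conv_mono)
    show "\<bar>backward_diff Q i\<bar> \<le> (if i = 0 then \<eta>\<^sub>1 else \<eta>)" if "i \<le> k" for i
      using P[of i] P1 that by (auto simp: backward_diff_def Q_def k)
  qed (rule S0)
  also have "\<dots> = S k * \<eta>\<^sub>1 + (\<Sum>i<k. S i * \<eta>)"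
  proof -
    have "conv S (\<lambda>i. if i = 0 then \<eta>\<^sub>1 else \<eta>) k = S k * \<eta>\<^sub>1 + (\<Sum>i=1..k. S (k - i) * \<eta>)"
      unfolding conv_def atLeast0AtMost[symmetric] by (simp add: sum.atLeast_Suc_atMost)
    then show ?thesis
      by (simp only: sum_diff_reindex[of "\<lambda>i. S i * \<eta>"])
  qed
  also have "\<dots> \<le> 3 / 2 * \<eta>\<^sub>1 + (\<Sum>i<n. S i) * \<eta>"
    using S1[of k] P1 S0 \<open>0 \<le> \<eta>\<close>
    by (intro add_mono mult_right_mono) (auto simp: sum_distrib_right[symmetric] k intro: mult_right_mono)
  also have "(\<Sum>i<n. S i) \<le> (\<Sum>s<n. weight_inv_sum \<alpha> s) * (\<Sum>s<n. centered_moment \<alpha> s)"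
    unfolding S_def by (intro sum_conv_le weight_inv_sum_nonneg \<alpha> centered_moment_nonneg)
  also have "\<dots> \<le> (\<Sum>s<n. weight_inv_sum \<alpha> s) * (3 / 2)"
    by (intro mult_left_mono sum_centered_moment sum_weight_inv_sum_nonneg)
  finally show ?thesis
    using \<open>0 \<le> \<eta>\<close> unfolding eq by (simp add: algebra_simps mult_right_mono)
qed

text \<open>The diagonal value \<open>p j j\<close> is constant along a column and falls under the
  preceding estimate. The rest vanishes at i = 0 and grows at most linearly, so partial summation in
  i applies.\<close>

lemma sum_conv_centered_moment_le:
  fixes p :: "nat \<Rightarrow> nat \<Rightarrow> real"
  assumes n: "1 \<le> n" and p1: "\<bar>p 1 1\<bar> \<le> \<eta>\<^sub>1"
    and diag: "\<And>j. 1 \<le> j \<Longrightarrow> j < n \<Longrightarrow> \<bar>p (Suc j) (Suc j) - p j j\<bar> \<le> \<eta>" and "0 \<le> \<eta>"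
    and incr: "\<And>m j. 1 \<le> j \<Longrightarrow> j \<le> m \<Longrightarrow> m < n \<Longrightarrow> \<bar>p (Suc m) j - p m j\<bar> \<le> \<delta>" and "0 \<le> \<delta>"
  shows "\<bar>\<Sum>j=1..n. conv (weight_inv \<alpha>) (\<lambda>i. centered_moment \<alpha> i * p (j + i) j) (n - j)\<bar>
    \<le> 3 / 2 * \<eta>\<^sub>1 + (3 / 2 * \<eta> + 3 * \<delta>) * (\<Sum>s<n. weight_inv_sum \<alpha> s)"
proof -
  let ?c = "centered_moment \<alpha>"
  \<comment> \<open>Product rule for the backward difference: the new moment times one increment of
    \<open>p\<close>, plus the decrease of the moments times the accumulated growth
    \<open>real (i - 1)\<close>. Each half sums to at most 3/2.\<close>
  define d where "d i = (if i = 0 then 0 else ?c i + real (i - 1) * (?c (i - 1) - ?c i))" for i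
  have d0: "0 \<le> d i" for i
    using centered_moment_nonneg[of i] centered_moment_Suc_le[of "i - 1"]
    by (auto simp: d_def)
  have dsum: "(\<Sum>i<n. d i) \<le> 3"
  proof -
    obtain k where k: "n = Suc k"
      using n by (cases n) auto
    have "(\<Sum>i<n. d i) = (\<Sum>i<k. ?c (Suc i)) + (\<Sum>i<k. real i * (?c i - ?c (Suc i)))"
      unfolding k sum.lessThan_Suc_shift by (simp add: d_def sum.distrib)
    also have "(\<Sum>i<k. ?c (Suc i)) = (\<Sum>i<Suc k. ?c i) - ?c 0"
      by (simp only: sum.lessThan_Suc_shift)
    finally show ?thesis
      using sum_centered_moment[of "Suc k"] centered_moment_nonneg[of 0]
        sum_index_centered_moment_diff[of k] by linarith
  qed
  have split: "conv (weight_inv \<alpha>) (\<lambda>i. ?c i * p (j + i) j) s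
      = p j j * conv (weight_inv \<alpha>) ?c s + conv (weight_inv \<alpha>) (\<lambda>i. ?c i * (p (j + i) j - p j j)) s"
    for j s
    unfolding conv_cmult[symmetric] conv_add[symmetric] by (simp add: algebra_simps)
  have rest: "\<bar>conv (weight_inv \<alpha>) (\<lambda>i. ?c i * (p (j + i) j - p j j)) (n - j)\<bar>
      \<le> \<delta> * conv (weight_inv_sum \<alpha>) d (n - j)" if j: "j \<in> {1..n}" for j
    unfolding conv_by_parts[OF \<alpha>] conv_cmult[symmetric]
  proof (rule conv_mono)
    fix i assume i: "i \<le> n - j"
    have le: "\<bar>p (j + m) j - p j j\<bar> \<le> real m * \<delta>" if "m \<le> n - j" for m
      using that
    proof (induction m)
      case (Suc m)
      then have "\<bar>p (Suc (j + m)) j - p (j + m) j\<bar> \<le> \<delta>" "\<bar>p (j + m) j - p j j\<bar> \<le> real m * \<delta>"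
        using incr[of j "j + m"] j by auto
      then show ?case
        unfolding add_Suc_right of_nat_Suc distrib_right by linarith
    qed simp
    show "\<bar>backward_diff (\<lambda>i. ?c i * (p (j + i) j - p j j)) i\<bar> \<le> \<delta> * d i"
    proof (cases i)
      case (Suc m)
      let ?q = "\<lambda>i. p (j + i) j - p j j"
      have "\<bar>?c i * ?q i - ?c m * ?q m\<bar> = \<bar>?c i * (p (Suc (j + m)) j - p (j + m) j) - (?c m - ?c i) * ?q m\<bar>"
        unfolding Suc add_Suc_right by (simp add: algebra_simps)
      also have "\<dots> \<le> \<bar>?c i * (p (Suc (j + m)) j - p (j + m) j)\<bar> + \<bar>(?c m - ?c i) * ?q m\<bar>"
        by (rule abs_triangle_ineq4)
      also have "\<dots> \<le> ?c i * \<delta> + (?c m - ?c i) * (real m * \<delta>)"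
        unfolding abs_mult
        using incr[of j "j + m"] le[of m] i j Suc centered_moment_nonneg[of i] centered_moment_Suc_le[of m]
        by (intro add_mono mult_mono) auto
      also have "\<dots> = \<delta> * d i"
        by (simp add: Suc d_def algebra_simps)
      finally show ?thesis
        by (simp add: Suc backward_diff_def)
    qed (simp add: backward_diff_def d_def)
  qed (rule weight_inv_sum_nonneg[OF \<alpha>])
  have "\<bar>\<Sum>j=1..n. conv (weight_inv \<alpha>) (\<lambda>i. ?c i * (p (j + i) j - p j j)) (n - j)\<bar>
      \<le> (\<Sum>j=1..n. \<delta> * conv (weight_inv_sum \<alpha>) d (n - j))"
    by (rule order_trans[OF sum_abs]) (rule sum_mono, rule rest)
  also have "\<dots> = \<delta> * (\<Sum>s<n. conv (weight_inv_sum \<alpha>) d s)"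
    unfolding sum_distrib_left[symmetric]
    by (simp only: sum_diff_reindex[of "conv (weight_inv_sum \<alpha>) d"])
  also have "\<dots> \<le> \<delta> * ((\<Sum>s<n. weight_inv_sum \<alpha> s) * (\<Sum>s<n. d s))"
    by (intro mult_left_mono sum_conv_le weight_inv_sum_nonneg \<alpha> d0 \<open>0 \<le> \<delta>\<close>)
  also have "\<dots> \<le> \<delta> * ((\<Sum>s<n. weight_inv_sum \<alpha> s) * 3)"
    by (intro mult_left_mono dsum sum_weight_inv_sum_nonneg \<open>0 \<le> \<delta>\<close>)
  finally have "\<bar>\<Sum>j=1..n. conv (weight_inv \<alpha>) (\<lambda>i. ?c i * (p (j + i) j - p j j)) (n - j)\<bar>
      \<le> 3 * \<delta> * (\<Sum>s<n. weight_inv_sum \<alpha> s)"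
    by (simp add: mult_ac)
  moreover have "\<bar>\<Sum>j=1..n. p j j * conv (weight_inv \<alpha>) ?c (n - j)\<bar>
      \<le> 3 / 2 * \<eta>\<^sub>1 + 3 / 2 * \<eta> * (\<Sum>s<n. weight_inv_sum \<alpha> s)"
    by (intro conv_centered_moment_diag_le n p1 diag \<open>0 \<le> \<eta>\<close>)
  ultimately have "\<bar>(\<Sum>j=1..n. p j j * conv (weight_inv \<alpha>) ?c (n - j))
      + (\<Sum>j=1..n. conv (weight_inv \<alpha>) (\<lambda>i. ?c i * (p (j + i) j - p j j)) (n - j))\<bar>
      \<le> (3 / 2 * \<eta>\<^sub>1 + 3 / 2 * \<eta> * (\<Sum>s<n. weight_inv_sum \<alpha> s))
        + 3 * \<delta> * (\<Sum>s<n. weight_inv_sum \<alpha> s)"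
    by (intro order_trans[OF abs_triangle_ineq add_mono])
  then show ?thesis
    by (simp only: split sum.distrib distrib_right add.assoc)
qed

text \<open>Comparison with an integral: (1 - \<alpha>) (n + 1) powr - \<alpha> is the Abel kernel
  of exponent 1 - \<alpha> at the far end of cell n, hence at most its weight, and these weights
  telescope.\<close>

lemma sum_weight_inv_sum_le: "(1 - \<alpha>) * (\<Sum>s<n. weight_inv_sum \<alpha> s) \<le> real n powr (1 - \<alpha>)"
proof (induction n)
  case (Suc n)
  have \<beta>: "0 < 1 - \<alpha>" "1 - \<alpha> < 1"
    using \<alpha> by auto
  have "(1 - \<alpha>) * weight_inv_sum \<alpha> n \<le> abel_kernel (1 - \<alpha>) n 1"
    using weight_inv_sum_le[OF \<alpha>, of n] \<alpha> by (simp add: abel_kernel_def)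
  also have "\<dots> \<le> weight (1 - \<alpha>) n"
  proof (rule has_integral_le[OF _ has_integral_half_open[OF abel_kernel_has_integral[OF \<beta>]]])
    show "((\<lambda>_. abel_kernel (1 - \<alpha>) n 1) has_integral abel_kernel (1 - \<alpha>) n 1) {0<..1::real}"
      using has_integral_half_open[OF has_integral_const_real[of "abel_kernel (1 - \<alpha>) n 1" 0 1]]
      by simp
  qed (auto intro: abel_kernel_antimono[OF \<beta>])
  finally show ?case
    using Suc.IH by (simp add: weight_def algebra_simps)
qed (use \<alpha> in simp)

end

section \<open>Stability and the Abel integral\<close>

text \<open>The mean value inequality for s |-> f s - f' z * s on the segment from z to y. It serves
  with \<beta> = 1 for the kernel and with \<beta> = \<gamma> - 1 for the solution.\<close>

lemma first_order_remainder:
  fixes f f' :: "real \<Rightarrow> real"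
  assumes S: "convex S" "z \<in> S" "y \<in> S"
    and f': "\<And>s. s \<in> S \<Longrightarrow> (f has_real_derivative f' s) (at s within S)"
    and M: "\<And>s. s \<in> S \<Longrightarrow> \<bar>f' s - f' z\<bar> \<le> M * \<bar>s - z\<bar> powr \<beta>"
    and "0 \<le> M" "0 \<le> \<beta>"
  shows "\<bar>f y - f z - f' z * (y - z)\<bar> \<le> M * \<bar>y - z\<bar> powr \<beta> * \<bar>y - z\<bar>"
proof -
  let ?T = "closed_segment z y"
  have sub: "?T \<subseteq> S"
    using S by (rule closed_segment_subset[rotated 2])
  have "norm ((f y - f' z * y) - (f z - f' z * z)) \<le> (M * \<bar>y - z\<bar> powr \<beta>) * norm (y - z)"
  proof (rule field_differentiable_bound[of ?T])
    fix s assume s: "s \<in> ?T"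
    show "((\<lambda>s. f s - f' z * s) has_field_derivative (f' s - f' z)) (at s within ?T)"
      using DERIV_subset[OF f' sub] s sub by (auto intro!: derivative_eq_intros)
    have "\<bar>s - z\<bar> \<le> \<bar>y - z\<bar>"
      using s by (auto simp: closed_segment_eq_real_ivl split: if_splits)
    then have "M * \<bar>s - z\<bar> powr \<beta> \<le> M * \<bar>y - z\<bar> powr \<beta>"
      using \<open>0 \<le> M\<close> \<open>0 \<le> \<beta>\<close> by (intro mult_left_mono powr_mono2) auto
    then show "norm (f' s - f' z) \<le> M * \<bar>y - z\<bar> powr \<beta>"
      using M[of s] s sub by fastforce
  qed auto
  then show ?thesis
    by (simp add: algebra_simps)
qed

lemma discrete_gronwall:
  fixes e :: "nat \<Rightarrow> real"
  assumes e: "\<And>n. 1 \<le> n \<Longrightarrow> n \<le> N \<Longrightarrow> e n \<le> B + c * (\<Sum>j=1..<n. e j)"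
    and "0 \<le> c"
    and n: "1 \<le> n" "n \<le> N"
  shows "e n \<le> B * (1 + c) ^ (n - 1)"
  using n
proof (induction n rule: less_induct)
  case (less n)
  have geom: "c * (\<Sum>j=1..<m. (1 + c) ^ (j - 1)) = (1 + c) ^ (m - 1) - 1" if "1 \<le> m" for m
    using that by (induction m rule: dec_induct) (auto simp: algebra_simps power_eq_if)
  have "e n \<le> B + c * (\<Sum>j=1..<n. e j)"
    using e less.prems by simp
  also have "\<dots> \<le> B + c * (\<Sum>j=1..<n. B * (1 + c) ^ (j - 1))"
    using \<open>0 \<le> c\<close> less.prems by (intro add_left_mono mult_left_mono sum_mono less.IH) auto
  also have "\<dots> = B + B * (c * (\<Sum>j=1..<n. (1 + c) ^ (j - 1)))"
    by (simp add: sum_distrib_left[symmetric] mult_ac)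
  also have "\<dots> = B * (1 + c) ^ (n - 1)"
    unfolding geom[OF less.prems(1)] by (simp add: algebra_simps)
  finally show ?case .
qed

text \<open>Summing by columns, with rows counted from the diagonal by m = j + i, makes each column
  a single convolution with \<open>p\<close>.\<close>

lemma sum_conv_swap:
  "(\<Sum>m=1..n. p (n - m) * (\<Sum>j=1..m. q m j)) = (\<Sum>j=1..n. conv p (\<lambda>i. q (j + i) j) (n - j))"
proof -
  have "(\<Sum>m=1..n. p (n - m) * (\<Sum>j=1..m. q m j)) = (\<Sum>(m, j)\<in>(SIGMA m:{1..n}. {1..m}). p (n - m) * q m j)"
    unfolding sum_distrib_left by (subst sum.Sigma) auto
  also have "\<dots> = (\<Sum>(j, i)\<in>(SIGMA j:{1..n}. {..n - j}). p (n - j - i) * q (j + i) j)"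
    by (rule sum.reindex_bij_witness[of _ "\<lambda>(j, i). (j + i, j)" "\<lambda>(m, j). (j, m - j)"]) auto
  also have "\<dots> = (\<Sum>j=1..n. conv p (\<lambda>i. q (j + i) j) (n - j))"
    unfolding conv_def by (subst sum.Sigma) auto
  finally show ?thesis .
qed

context
  fixes \<alpha> :: real
  assumes \<alpha>: "0 < \<alpha>" "\<alpha> < 1"
begin

text \<open>On cell j the substitution t = j - y / h gives m h - y = h (m - j + t); the kernel
  contributes h powr (\<alpha> - 1) and the substitution a further h.\<close>

lemma abel_integral_eq_moments:
  assumes h: "0 < h" and cont: "continuous_on {0..real m * h} \<phi>"
  shows "((\<lambda>y. \<alpha> * (real m * h - y) powr (\<alpha> - 1) * \<phi> y) has_integral
    h powr \<alpha> * (\<Sum>j=1..m. moment \<alpha> (m - j) (\<lambda>t. \<phi> (real j * h - t * h)))) {0..real m * h}"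
proof -
  define g where "g y = \<alpha> * (real m * h - y) powr (\<alpha> - 1) * \<phi> y" for y
  define I where "I j = h powr \<alpha> * moment \<alpha> (m - j) (\<lambda>t. \<phi> (real j * h - t * h))" for j
  have piece: "(g has_integral I j) {real (j - 1) * h..real j * h}" if j: "1 \<le> j" "j \<le> m" for j
  proof -
    have jr: "real (m - j) = real m - real j" "real (j - 1) = real j - 1"
      using j by auto
    have sub: "real j * h - t * h \<in> {0..real m * h}" if "t \<in> {0..1}" for t
    proof -
      have "0 \<le> (real j - t) * h" "(real j - t) * h \<le> real m * h"
        using that j h by (auto intro!: mult_nonneg_nonneg mult_right_mono)
      then show ?thesis by (simp add: algebra_simps)
    qed
    have "continuous_on {0..1} (\<lambda>t. \<phi> (real j * h - t * h))"
      using sub by (intro continuous_on_compose2[OF cont] continuous_intros) auto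
    from moment_has_integral[OF \<alpha> this, of "m - j"]
    have "((\<lambda>t. abel_kernel \<alpha> (m - j) t * \<phi> (real j * h - t * h)) has_integral
        moment \<alpha> (m - j) (\<lambda>t. \<phi> (real j * h - t * h))) (cbox 0 1)"
      by simp
    from has_integral_affinity[OF this, of "- 1 / h" "real j"] h
    have "((\<lambda>y. abel_kernel \<alpha> (m - j) (real j - y / h) * \<phi> (real j * h - (real j - y / h) * h)) has_integral
        h * moment \<alpha> (m - j) (\<lambda>t. \<phi> (real j * h - t * h))) ((\<lambda>t. h * real j - h * t) ` {0..1})"
      by (simp add: algebra_simps)
    also have "(\<lambda>t. h * real j - h * t) ` {0..1} = {real (j - 1) * h..real j * h}"
    proof -
      have "(\<lambda>t. (- h) * t + h * real j) ` {0..1} = {real (j - 1) * h..real j * h}"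
        using h unfolding image_affinity_atLeastAtMost by (simp add: jr[simplified] algebra_simps)
      then show ?thesis by (simp add: algebra_simps)
    qed
    finally have "((\<lambda>y. h powr (\<alpha> - 1) * (abel_kernel \<alpha> (m - j) (real j - y / h)
        * \<phi> (real j * h - (real j - y / h) * h))) has_integral
        h powr (\<alpha> - 1) * (h * moment \<alpha> (m - j) (\<lambda>t. \<phi> (real j * h - t * h))))
        {real (j - 1) * h..real j * h}"
      by (rule has_integral_mult_right)
    moreover have "h powr (\<alpha> - 1) * h = h powr \<alpha>"
      using h by (simp add: powr_diff)
    ultimately have *: "((\<lambda>y. h powr (\<alpha> - 1) * (abel_kernel \<alpha> (m - j) (real j - y / h)
        * \<phi> (real j * h - (real j - y / h) * h))) has_integral I j) {real (j - 1) * h..real j * h}"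
      by (simp add: I_def mult.assoc[symmetric])
    show ?thesis
    proof (rule has_integral_eq[OF _ *])
      fix y assume y: "y \<in> {real (j - 1) * h..real j * h}"
      have "real j * h \<le> real m * h"
        using j h by (intro mult_right_mono) auto
      then have y': "0 \<le> real m * h - y"
        using y by auto
      have "real (m - j) + (real j - y / h) = (real m * h - y) / h"
        using h by (simp add: jr field_simps)
      then have "h powr (\<alpha> - 1) * abel_kernel \<alpha> (m - j) (real j - y / h)
          = \<alpha> * (real m * h - y) powr (\<alpha> - 1)"
        using h y' by (simp add: abel_kernel_def powr_divide)
      moreover have "real j * h - (real j - y / h) * h = y"
        using h by (simp add: field_simps)
      ultimately show "h powr (\<alpha> - 1) * (abel_kernel \<alpha> (m - j) (real j - y / h)
          * \<phi> (real j * h - (real j - y / h) * h)) = g y"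
        by (simp add: g_def mult.assoc[symmetric])
    qed
  qed
  have "(g has_integral (\<Sum>j=1..i. I j)) {0..real i * h}" if "i \<le> m" for i
    using that
  proof (induction i)
    case (Suc i)
    have "(g has_integral (\<Sum>j=1..i. I j) + I (Suc i)) {0..real (Suc i) * h}"
    proof (rule has_integral_combine)
      show "(g has_integral I (Suc i)) {real i * h..real (Suc i) * h}"
        using piece[of "Suc i"] Suc.prems by simp
    qed (use Suc h in auto)
    then show ?case by simp
  qed (simp add: has_integral_refl)
  from this[of m] show ?thesis
    by (simp add: g_def[abs_def] I_def sum_distrib_left[symmetric] cong: sum.cong)
qed

text \<open>Applying the inverse of the weights to the system turns it into the identity plus a
  perturbation of size \<open>O(h)\<close> per entry.\<close>
lemma weighted_system_stable:
  fixes K :: "nat \<Rightarrow> nat \<Rightarrow> real"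
  assumes eq: "\<And>m. 1 \<le> m \<Longrightarrow> m \<le> N \<Longrightarrow> (\<Sum>j=1..m. weight \<alpha> (m - j) * K m j * e j) = b m"
    and K0: "\<And>j. 1 \<le> j \<Longrightarrow> j \<le> N \<Longrightarrow> \<bar>K j j - 1\<bar> \<le> c"
    and K1: "\<And>m j. 1 \<le> j \<Longrightarrow> j \<le> m \<Longrightarrow> m < N \<Longrightarrow> \<bar>K (Suc m) j - K m j\<bar> \<le> c"
    and B: "\<And>n. 1 \<le> n \<Longrightarrow> n \<le> N \<Longrightarrow> \<bar>\<Sum>m=1..n. weight_inv \<alpha> (n - m) * b m\<bar> \<le> B"
    and c: "0 \<le> c" "6 * c \<le> 1"
    and n: "1 \<le> n" "n \<le> N"
  shows "\<bar>e n\<bar> \<le> 2 * B * exp (6 * c * real N)"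
proof -
  \<comment> \<open>The transformed matrix minus the identity. The part of column j proportional to
    the weights survives only on the diagonal; the rest measures the variation of \<open>K\<close>
    down the column.\<close>
  define M where "M n j = (K j j - 1) * (if n = j then 1 else 0)
    + conv (weight_inv \<alpha>) (\<lambda>i. moment \<alpha> i (\<lambda>_. K (j + i) j - K j j)) (n - j)" for n j
  have M: "\<bar>M n j\<bar> \<le> 3 * c" if "1 \<le> j" "j \<le> n" "n \<le> N" for n j
  proof -
    have "\<bar>conv (weight_inv \<alpha>) (\<lambda>i. moment \<alpha> i (\<lambda>_. K (j + i) j - K j j)) (n - j)\<bar> \<le> 2 * c"
      using that c by (intro conv_moment_increments_le \<alpha>) (auto intro!: K1)
    moreover have "\<bar>(K j j - 1) * (if n = j then 1 else 0)\<bar> \<le> c"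
      using K0[of j] that c by auto
    ultimately show ?thesis
      unfolding M_def by linarith
  qed
  have expand: "(\<Sum>m=1..n. weight_inv \<alpha> (n - m) * b m) = e n + (\<Sum>j=1..n. M n j * e j)"
    if n: "1 \<le> n" "n \<le> N" for n
  proof -
    have "(\<Sum>m=1..n. weight_inv \<alpha> (n - m) * b m)
        = (\<Sum>m=1..n. weight_inv \<alpha> (n - m) * (\<Sum>j=1..m. weight \<alpha> (m - j) * K m j * e j))"
      using n by (intro sum.cong refl) (simp add: eq[symmetric])
    also have "\<dots> = (\<Sum>j=1..n. conv (weight_inv \<alpha>) (\<lambda>i. weight \<alpha> i * K (j + i) j * e j) (n - j))"
      using sum_conv_swap[of "weight_inv \<alpha>" n "\<lambda>m j. weight \<alpha> (m - j) * K m j * e j"] by simp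
    also have "\<dots> = (\<Sum>j=1..n. (if n = j then 1 else 0) * e j + M n j * e j)"
    proof (rule sum.cong[OF refl])
      fix j assume j: "j \<in> {1..n}"
      \<comment> \<open>A weight times a number is the moment of a constant function, so the
        estimate for moments with small increments applies to \<open>K\<close> as well.\<close>
      have "(\<lambda>i. weight \<alpha> i * K (j + i) j * e j)
          = (\<lambda>i. e j * (K j j * weight \<alpha> i + moment \<alpha> i (\<lambda>_. K (j + i) j - K j j)))"
        by (simp add: moment_const[OF \<alpha>] algebra_simps)
      then have "conv (weight_inv \<alpha>) (\<lambda>i. weight \<alpha> i * K (j + i) j * e j) (n - j)
          = e j * (K j j * (if n - j = 0 then 1 else 0)
            + conv (weight_inv \<alpha>) (\<lambda>i. moment \<alpha> i (\<lambda>_. K (j + i) j - K j j)) (n - j))"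
        by (simp only: conv_cmult conv_add conv_weight_inv_weight[OF \<alpha>])
      also have "\<dots> = (if n = j then 1 else 0) * e j + M n j * e j"
        using j by (auto simp: M_def algebra_simps)
      finally show "conv (weight_inv \<alpha>) (\<lambda>i. weight \<alpha> i * K (j + i) j * e j) (n - j) = \<dots>" .
    qed
    also have "\<dots> = e n + (\<Sum>j=1..n. M n j * e j)"
      using n by (simp add: sum.distrib if_distrib[of "\<lambda>c. c * _"] cong: if_cong)
    finally show ?thesis .
  qed
  have rec: "\<bar>e n\<bar> \<le> 2 * B + 6 * c * (\<Sum>j=1..<n. \<bar>e j\<bar>)" if n: "1 \<le> n" "n \<le> N" for n
  proof -
    have "\<bar>\<Sum>j=1..n. M n j * e j\<bar> \<le> (\<Sum>j=1..n. 3 * c * \<bar>e j\<bar>)"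
      by (rule order_trans[OF sum_abs], rule sum_mono)
         (use M n in \<open>auto simp: abs_mult intro!: mult_right_mono\<close>)
    also have "\<dots> = 3 * c * (\<Sum>j=1..<n. \<bar>e j\<bar>) + 3 * c * \<bar>e n\<bar>"
      using n by (simp add: sum_distrib_left sum.last_plus algebra_simps)
    \<comment> \<open>Here 6 c \<le> 1 lets the diagonal term be absorbed on the left; this doubles
      the remaining constants.\<close>
    also have "3 * c * \<bar>e n\<bar> \<le> 1 / 2 * \<bar>e n\<bar>"
      using c by (intro mult_right_mono) auto
    finally have "\<bar>\<Sum>j=1..n. M n j * e j\<bar> \<le> 3 * c * (\<Sum>j=1..<n. \<bar>e j\<bar>) + 1 / 2 * \<bar>e n\<bar>"
      by simp
    then show ?thesis
      using B[OF n] unfolding expand[OF n] by linarith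
  qed
  have B0: "0 \<le> B"
    using B[OF n] by linarith
  have "\<bar>e n\<bar> \<le> 2 * B * (1 + 6 * c) ^ (n - 1)"
    by (rule discrete_gronwall[OF rec]) (use c n in auto)
  also have "\<dots> \<le> 2 * B * exp (6 * c * real N)"
  proof (rule mult_left_mono)
    have "(1 + 6 * c) ^ (n - 1) \<le> exp (6 * c) ^ (n - 1)"
      using c exp_ge_add_one_self[of "6 * c"] by (intro power_mono) auto
    also have "\<dots> = exp (6 * c * real (n - 1))"
      by (simp add: exp_of_nat_mult[symmetric] mult_ac)
    also have "\<dots> \<le> exp (6 * c * real N)"
      using c n by (auto intro!: mult_left_mono)
    finally show "(1 + 6 * c) ^ (n - 1) \<le> exp (6 * c * real N)" .
  qed (use B0 in simp)
  finally show ?thesis .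
qed

lemma conv_noise_le:
  assumes "\<And>m. 1 \<le> m \<Longrightarrow> m \<le> n \<Longrightarrow> \<bar>b m\<bar> \<le> \<delta>" and "0 \<le> \<delta>"
  shows "\<bar>\<Sum>m=1..n. weight_inv \<alpha> (n - m) * b m\<bar> \<le> 2 * \<delta>"
proof -
  have "\<bar>\<Sum>m=1..n. weight_inv \<alpha> (n - m) * b m\<bar> \<le> (\<Sum>m=1..n. \<bar>weight_inv \<alpha> (n - m)\<bar> * \<delta>)"
    by (rule order_trans[OF sum_abs], rule sum_mono)
       (use assms in \<open>auto simp: abs_mult intro!: mult_left_mono\<close>)
  also have "\<dots> = (\<Sum>s<n. \<bar>weight_inv \<alpha> s\<bar>) * \<delta>"
    by (simp only: sum_distrib_right[symmetric] sum_diff_reindex[of "\<lambda>s. \<bar>weight_inv \<alpha> s\<bar>"])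
  also have "\<dots> \<le> 2 * \<delta>"
    by (intro mult_right_mono sum_abs_weight_inv \<alpha> \<open>0 \<le> \<delta>\<close>)
  finally show ?thesis .
qed

end

section \<open>Quadrature error\<close>

text \<open>\<open>k'\<close> is the partial derivative of \<open>k\<close> in the second variable.\<close>
locale smooth_kernel =
  fixes a :: real and k k' :: "real \<Rightarrow> real \<Rightarrow> real" and L :: real
  assumes L_nonneg: "0 \<le> L"
    and k_bound: "\<lbrakk>0 \<le> y; y \<le> x; x \<le> a\<rbrakk> \<Longrightarrow> \<bar>k x y\<bar> \<le> L"
    and k_lip: "\<lbrakk>0 \<le> y; y \<le> x; x \<le> a; 0 \<le> z; z \<le> w; w \<le> a\<rbrakk>
      \<Longrightarrow> \<bar>k x y - k w z\<bar> \<le> L * (\<bar>x - w\<bar> + \<bar>y - z\<bar>)"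
    and k'_bound: "\<lbrakk>0 \<le> y; y \<le> x; x \<le> a\<rbrakk> \<Longrightarrow> \<bar>k' x y\<bar> \<le> L"
    and k'_lip: "\<lbrakk>0 \<le> y; y \<le> x; x \<le> a; 0 \<le> z; z \<le> w; w \<le> a\<rbrakk>
      \<Longrightarrow> \<bar>k' x y - k' w z\<bar> \<le> L * (\<bar>x - w\<bar> + \<bar>y - z\<bar>)"
    and k_mixed: "\<lbrakk>0 \<le> y; y \<le> w; 0 \<le> z; z \<le> w; w \<le> x; x \<le> a\<rbrakk>
      \<Longrightarrow> \<bar>(k x y - k w y) - (k x z - k w z)\<bar> \<le> L * (x - w) * \<bar>y - z\<bar>"
    and k_remainder: "\<lbrakk>0 \<le> y; y \<le> x; 0 \<le> z; z \<le> x; x \<le> a\<rbrakk>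
      \<Longrightarrow> \<bar>k x y - k x z - k' x z * (y - z)\<bar> \<le> L * (y - z)\<^sup>2"
    and k_remainder_mixed: "\<lbrakk>0 \<le> y; y \<le> w; 0 \<le> z; z \<le> w; w \<le> x; x \<le> a\<rbrakk>
      \<Longrightarrow> \<bar>(k x y - k x z - k' x z * (y - z)) - (k w y - k w z - k' w z * (y - z))\<bar>
        \<le> L * (x - w) * (y - z)\<^sup>2"

text \<open>For the mixed bounds the mean value theorem in y is applied to the difference of the
  sections at x and w: its y-derivative is at most L (x - w), because the next y-derivative of k is
  Lipschitz in x.\<close>

lemma lipschitz_partials_imp_smooth_kernel:
  assumes a: "0 < a" and lip: "lipschitz_partials 2 a k"
  obtains k' L where "smooth_kernel a k k' L"
proof -
  obtain D where D: "\<forall>(x, y)\<in>triangle a. D 0 0 x y = k x y"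
      "\<forall>i j. i + j < 2 \<longrightarrow> (\<forall>(x, y)\<in>triangle a.
        ((\<lambda>s. D i j s y) has_real_derivative D (Suc i) j x y) (at x within {y..a}) \<and>
        ((\<lambda>t. D i j x t) has_real_derivative D i (Suc j) x y) (at y within {0..x}))"
      "\<forall>i j. i + j \<le> 2 \<longrightarrow> (\<exists>L. L-lipschitz_on (triangle a) (\<lambda>(x, y). D i j x y))"
    using lip unfolding lipschitz_partials_def by blast
  have D0: "D 0 0 x y = k x y" if "(x, y) \<in> triangle a" for x y
    using D(1) that by auto
  have Dy: "((\<lambda>t. D i j x t) has_real_derivative D i (Suc j) x y) (at y within {0..x})"
    if "i + j < 2" "(x, y) \<in> triangle a" for i j x y
    using D(2) that by fast
  define P where "P j L \<longleftrightarrow> 0 \<le> L \<and> (\<forall>x y w z. (x, y) \<in> triangle a \<longrightarrow> (w, z) \<in> triangle a \<longrightarrow>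
      \<bar>D 0 j x y - D 0 j w z\<bar> \<le> L * (\<bar>x - w\<bar> + \<bar>y - z\<bar>))" for j L
  have "\<exists>L. P j L" if j: "j \<le> 2" for j
  proof -
    obtain L where L: "L-lipschitz_on (triangle a) (\<lambda>(x, y). D 0 j x y)"
      using D(3)[rule_format, of 0 j] j by auto
    have "\<bar>D 0 j x y - D 0 j w z\<bar> \<le> L * (\<bar>x - w\<bar> + \<bar>y - z\<bar>)"
      if "(x, y) \<in> triangle a" "(w, z) \<in> triangle a" for x y w z
    proof -
      have "\<bar>D 0 j x y - D 0 j w z\<bar> \<le> L * dist (x, y) (w, z)"
        using lipschitz_onD[OF L that] by (simp add: dist_real_def)
      also have "\<dots> \<le> L * (\<bar>x - w\<bar> + \<bar>y - z\<bar>)"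
        using lipschitz_on_nonneg[OF L] sqrt_sum_squares_le_sum_abs
        by (intro mult_left_mono) (auto simp: dist_Pair_Pair dist_real_def)
      finally show ?thesis .
    qed
    with lipschitz_on_nonneg[OF L] show ?thesis unfolding P_def by blast
  qed
  then obtain M where MP: "\<And>j. j \<le> 2 \<Longrightarrow> P j (M j)"
    by metis
  have M0: "0 \<le> M j" if "j \<le> 2" for j
    using MP[OF that] by (simp add: P_def)
  have M: "\<bar>D 0 j x y - D 0 j w z\<bar> \<le> M j * (\<bar>x - w\<bar> + \<bar>y - z\<bar>)"
    if "j \<le> 2" "(x, y) \<in> triangle a" "(w, z) \<in> triangle a" for j x y w z
    using MP[OF that(1)] that(2,3) unfolding P_def by blast
  \<comment> \<open>On the triangle |x| + |y| \<le> 2 a, so this bounds the functions through their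
    values at the origin; the additional 1 makes L dominate the Lipschitz constants
    \<open>M j\<close> too.\<close>
  define L where "L = (\<Sum>j\<le>2. M j * (2 * a + 1)) + \<bar>D 0 0 0 0\<bar> + \<bar>D 0 1 0 0\<bar>"
  have M_bd: "M j * (2 * a + 1) + \<bar>D 0 0 0 0\<bar> + \<bar>D 0 1 0 0\<bar> \<le> L" if "j \<le> 2" for j
    unfolding L_def using that M0 a
    by (intro add_right_mono member_le_sum[where f = "\<lambda>j. M j * (2 * a + 1)"]) auto
  have M_le_L: "M j \<le> L" if "j \<le> 2" for j
  proof -
    have "M j * 1 \<le> M j * (2 * a + 1)"
      using M0[OF that] a by (intro mult_left_mono) auto
    with M_bd[OF that] show ?thesis by linarith
  qed
  have L0: "0 \<le> L"
    using M0[of 0] M_le_L[of 0] by linarith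
  have lipL: "\<bar>D 0 j x y - D 0 j w z\<bar> \<le> L * (\<bar>x - w\<bar> + \<bar>y - z\<bar>)"
    if "j \<le> 2" "(x, y) \<in> triangle a" "(w, z) \<in> triangle a" for j x y w z
    using M[OF that] mult_right_mono[OF M_le_L[OF that(1)], of "\<bar>x - w\<bar> + \<bar>y - z\<bar>"] by linarith
  have bound: "\<bar>D 0 j x y\<bar> \<le> L" if j: "j \<le> 1" and xy: "(x, y) \<in> triangle a" for j x y
  proof -
    have "(0, 0) \<in> triangle a"
      using a by (simp add: triangle_def)
    from M[OF _ xy this, of j] j
    have "\<bar>D 0 j x y\<bar> \<le> M j * (\<bar>x - 0\<bar> + \<bar>y - 0\<bar>) + \<bar>D 0 j 0 0\<bar>"
      by linarith
    also have "M j * (\<bar>x - 0\<bar> + \<bar>y - 0\<bar>) \<le> M j * (2 * a + 1)"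
      using xy M0[of j] j by (intro mult_left_mono) (auto simp: triangle_def)
    also have "\<bar>D 0 j 0 0\<bar> \<le> \<bar>D 0 0 0 0\<bar> + \<bar>D 0 1 0 0\<bar>"
      using j by (cases j) auto
    finally show ?thesis
      using M_bd[of j] j by linarith
  qed
  \<comment> \<open>Restricted to {0..w} because the sections at x and at w \<le> x have that
    segment in common.\<close>
  have der: "((\<lambda>t. D 0 j x t) has_real_derivative D 0 (Suc j) x s) (at s within {0..w})"
    if "j \<le> 1" "0 \<le> s" "s \<le> w" "w \<le> x" "x \<le> a" for j x s w
    by (rule DERIV_subset[OF Dy]) (use that in \<open>auto simp: triangle_def\<close>)
  have diff_der: "((\<lambda>t. D 0 j x t - D 0 j w t) has_real_derivative D 0 (Suc j) x s - D 0 (Suc j) w s)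
      (at s within {0..w})"
    if "j \<le> 1" "s \<in> {0..w}" "w \<le> x" "x \<le> a" for j x s w
    using that by (intro DERIV_diff der) auto
  have mixed: "\<bar>(D 0 j x y - D 0 j w y) - (D 0 j x z - D 0 j w z)\<bar> \<le> L * (x - w) * \<bar>y - z\<bar>"
    if j: "j \<le> 1" and yz: "0 \<le> y" "y \<le> w" "0 \<le> z" "z \<le> w" "w \<le> x" "x \<le> a" for j x y w z
  proof -
    have "norm ((D 0 j x y - D 0 j w y) - (D 0 j x z - D 0 j w z)) \<le> L * (x - w) * norm (y - z)"
    proof (rule field_differentiable_bound[of "{0..w}"])
      fix s assume s: "s \<in> {0..w}"
      show "((\<lambda>t. D 0 j x t - D 0 j w t) has_field_derivative D 0 (Suc j) x s - D 0 (Suc j) w s)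
          (at s within {0..w})"
        using diff_der[OF j s] yz by auto
      show "norm (D 0 (Suc j) x s - D 0 (Suc j) w s) \<le> L * (x - w)"
        using lipL[of "Suc j" x s w s] s yz j by (simp add: triangle_def)
    qed (use yz in auto)
    then show ?thesis by simp
  qed
  have sq: "(c * \<bar>t\<bar> powr 1) * \<bar>t\<bar> = c * t\<^sup>2" for c t :: real
    by (simp add: power2_eq_square mult.assoc)
  have D0': "D 0 0 x y = k x y" if "0 \<le> y" "y \<le> x" "x \<le> a" for x y
    using D0 that by (auto simp: triangle_def)
  have "smooth_kernel a k (D 0 1) L"
  proof
    fix x y z w
    assume A: "0 \<le> y" "y \<le> w" "0 \<le> z" "z \<le> w" "w \<le> x" "x \<le> a"
    show "\<bar>(k x y - k w y) - (k x z - k w z)\<bar> \<le> L * (x - w) * \<bar>y - z\<bar>"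
      using mixed[of 0 y w z x] A by (simp add: D0')
    have "\<bar>(D 0 0 x y - D 0 0 w y) - (D 0 0 x z - D 0 0 w z) - (D 0 1 x z - D 0 1 w z) * (y - z)\<bar>
        \<le> L * (x - w) * \<bar>y - z\<bar> powr 1 * \<bar>y - z\<bar>"
    proof (rule first_order_remainder[of "{0..w}"])
      fix s assume s: "s \<in> {0..w}"
      show "((\<lambda>t. D 0 0 x t - D 0 0 w t) has_real_derivative D 0 1 x s - D 0 1 w s) (at s within {0..w})"
        using diff_der[of 0 s w x] s A by simp
      show "\<bar>D 0 1 x s - D 0 1 w s - (D 0 1 x z - D 0 1 w z)\<bar> \<le> L * (x - w) * \<bar>s - z\<bar> powr 1"
        using mixed[of 1 s w z x] s A by simp
    qed (use A L0 in auto)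
    then show "\<bar>(k x y - k x z - D 0 1 x z * (y - z)) - (k w y - k w z - D 0 1 w z * (y - z))\<bar>
        \<le> L * (x - w) * (y - z)\<^sup>2"
      unfolding sq using A by (simp add: D0' algebra_simps)
  next
    fix x y z
    assume A: "0 \<le> y" "y \<le> x" "0 \<le> z" "z \<le> x" "x \<le> a"
    have "\<bar>D 0 0 x y - D 0 0 x z - D 0 1 x z * (y - z)\<bar> \<le> L * \<bar>y - z\<bar> powr 1 * \<bar>y - z\<bar>"
    proof (rule first_order_remainder[of "{0..x}"])
      fix s assume s: "s \<in> {0..x}"
      show "(D 0 0 x has_real_derivative D 0 1 x s) (at s within {0..x})"
        using der[of 0 s x x] s A by simp
      show "\<bar>D 0 1 x s - D 0 1 x z\<bar> \<le> L * \<bar>s - z\<bar> powr 1"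
        using lipL[of 1 x s x z] s A by (simp add: triangle_def)
    qed (use A L0 in auto)
    then show "\<bar>k x y - k x z - D 0 1 x z * (y - z)\<bar> \<le> L * (y - z)\<^sup>2"
      unfolding sq using A by (simp add: D0')
  qed (use L0 bound[of 0] bound[of 1] lipL[of 0] lipL[of 1] D0' in \<open>auto simp: triangle_def\<close>)
  then show ?thesis
    by (rule that)
qed

text \<open>The integrand of the quadrature error on the \<open>j\<close>-th cell, as a function of the local
  coordinate \<open>t = j - y / h\<close>.\<close>
definition quad_diff ::
  "(real \<Rightarrow> real \<Rightarrow> real) \<Rightarrow> (real \<Rightarrow> real) \<Rightarrow> real \<Rightarrow> nat \<Rightarrow> nat \<Rightarrow> real \<Rightarrow> real" where
  "quad_diff k u h m j t = k (real m * h) (real j * h - t * h) * u (real j * h - t * h)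
    - k (real m * h) ((real j - 1/2) * h) * u ((real j - 1/2) * h)"

lemma product_diff: "p * r - q * s = p * (r - s) + (p - q) * s"
  for p q r s :: real
  by (simp add: algebra_simps)

text \<open>Meant for kernel values p, q in one row and p', q' in the next, at a cell point and at
  the midpoint. Each term on the right contains a difference of rows, which supplies the extra
  factor h.\<close>

lemma product_diff_diff:
  "(p' * r - q' * s) - (p * r - q * s) = (p' - p) * (r - s) + ((p' - p) - (q' - q)) * s"
  for p p' q q' r s :: real
  by (simp add: algebra_simps)

section \<open>Kernel differences within a cell and between neighbouring rows\<close>

context smooth_kernel
begin

lemma k_step:
  assumes "0 \<le> y" "y \<le> x" "x \<le> w" "w \<le> a"
  shows "\<bar>k w y - k x y\<bar> \<le> L * (w - x)" "\<bar>k' w y - k' x y\<bar> \<le> L * (w - x)"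
  using k_lip[of y w y x] k'_lip[of y w y x] assms by auto

lemma k_cell:
  assumes "0 \<le> y" "y \<le> x" "0 \<le> z" "z \<le> x" "x \<le> a" "\<bar>y - z\<bar> \<le> h"
  shows "\<bar>k x y - k x z\<bar> \<le> L * h"
    and "\<bar>k x y - k x z - k' x z * (y - z)\<bar> \<le> L * (h * h)"
proof -
  have "\<bar>k x y - k x z\<bar> \<le> L * \<bar>y - z\<bar>"
    using k_lip[of y x z x] assms by auto
  also have "\<dots> \<le> L * h"
    by (intro mult_left_mono assms L_nonneg)
  finally show "\<bar>k x y - k x z\<bar> \<le> L * h" .
  have "\<bar>k x y - k x z - k' x z * (y - z)\<bar> \<le> L * (y - z)\<^sup>2"
    by (intro k_remainder assms)
  also have "\<dots> \<le> L * h\<^sup>2"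
    using assms(6) by (intro mult_left_mono L_nonneg) (auto intro: abs_le_square_iff[THEN iffD1])
  finally show "\<bar>k x y - k x z - k' x z * (y - z)\<bar> \<le> L * (h * h)"
    by (simp add: power2_eq_square)
qed

lemma k_cell_step:
  assumes "0 \<le> y" "y \<le> x" "0 \<le> z" "z \<le> x" "x \<le> w" "w \<le> a" "\<bar>y - z\<bar> \<le> h"
  shows "\<bar>(k w y - k x y) - (k w z - k x z)\<bar> \<le> L * (w - x) * h"
    and "\<bar>(k w y - k w z - k' w z * (y - z)) - (k x y - k x z - k' x z * (y - z))\<bar>
      \<le> L * (w - x) * (h * h)"
proof -
  have Lw: "0 \<le> L * (w - x)"
    using assms L_nonneg by simp
  have "\<bar>(k w y - k x y) - (k w z - k x z)\<bar> \<le> L * (w - x) * \<bar>y - z\<bar>"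
    by (intro k_mixed assms)
  also have "\<dots> \<le> L * (w - x) * h"
    by (intro mult_left_mono assms Lw)
  finally show "\<bar>(k w y - k x y) - (k w z - k x z)\<bar> \<le> L * (w - x) * h" .
  have "\<bar>(k w y - k w z - k' w z * (y - z)) - (k x y - k x z - k' x z * (y - z))\<bar>
      \<le> L * (w - x) * (y - z)\<^sup>2"
    by (intro k_remainder_mixed assms)
  also have "\<dots> \<le> L * (w - x) * h\<^sup>2"
    using assms(7) by (intro mult_left_mono Lw) (auto intro: abs_le_square_iff[THEN iffD1])
  finally show "\<bar>(k w y - k w z - k' w z * (y - z)) - (k x y - k x z - k' x z * (y - z))\<bar>
      \<le> L * (w - x) * (h * h)"
    by (simp add: power2_eq_square)
qed

end

text \<open>The bound h \<le> 1 makes powers of h decrease in the exponent, so terms of several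
  orders can be collected in the lowest one.\<close>

locale abel_scheme = smooth_kernel a k k' L
  for a :: real and k k' :: "real \<Rightarrow> real \<Rightarrow> real" and L :: real +
  fixes \<alpha> h U :: real and u :: "real \<Rightarrow> real" and N :: nat
  assumes \<alpha>: "0 < \<alpha>" "\<alpha> < 1"
    and h: "0 < h" "h \<le> 1" "real N * h = a"
    and u_cont: "continuous_on {0..a} u"
    and u_bound: "x \<in> {0..a} \<Longrightarrow> \<bar>u x\<bar> \<le> U"
begin

lemma U_nonneg: "0 \<le> U"
proof -
  have "0 \<in> {0..a}"
    using h by (auto simp flip: h(3))
  from u_bound[OF this] show ?thesis
    by linarith
qed

lemma grid_mono: "m \<le> n \<Longrightarrow> real m * h \<le> real n * h"
  using h by (intro mult_right_mono) auto

lemma cell: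
  assumes "1 \<le> j" "t \<in> {0..1}"
  shows "0 \<le> real j * h - t * h" "real j * h - t * h \<le> real j * h"
    "\<bar>(real j * h - t * h) - (real j - 1/2) * h\<bar> \<le> h"
proof -
  have "0 \<le> (real j - t) * h"
    using assms h by (intro mult_nonneg_nonneg) auto
  then show "0 \<le> real j * h - t * h"
    by (simp add: algebra_simps)
  show "real j * h - t * h \<le> real j * h"
    using assms h by simp
  have eq: "(real j * h - t * h) - (real j - 1/2) * h = h * (1/2 - t)"
    by (simp add: algebra_simps)
  have "\<bar>1/2 - t\<bar> \<le> 1"
    using assms by (auto simp: abs_if)
  then show "\<bar>(real j * h - t * h) - (real j - 1/2) * h\<bar> \<le> h"
    unfolding eq using h by (simp add: abs_mult)
qed

lemma midpoint:
  assumes "1 \<le> j"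
  shows "0 \<le> (real j - 1/2) * h" "(real j - 1/2) * h \<le> real j * h"
  using assms h by (auto intro!: mult_nonneg_nonneg simp: algebra_simps)

lemma grid_le: "m \<le> N \<Longrightarrow> real m * h \<le> a"
  using grid_mono[of m N] h by simp

lemma cell_in:
  assumes "1 \<le> j" "j \<le> m" "m \<le> N" "t \<in> {0..1}"
  shows "real j * h - t * h \<in> {0..a}" "real j * h - t * h \<le> real m * h"
  using cell(1,2)[OF assms(1,4)] grid_mono[OF assms(2)] grid_le[OF assms(3)] by auto

lemma midpoint_in:
  assumes "1 \<le> j" "j \<le> m" "m \<le> N"
  shows "(real j - 1/2) * h \<in> {0..a}" "(real j - 1/2) * h \<le> real m * h"
  using midpoint[OF assms(1)] grid_mono[OF assms(2)] grid_le[OF assms(3)] by auto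

lemma k_continuous: "0 \<le> x \<Longrightarrow> x \<le> a \<Longrightarrow> continuous_on {0..x} (k x)"
  by (rule lipschitz_on_continuous_on[of L], rule lipschitz_onI)
     (use L_nonneg k_lip[of _ x _ x] in \<open>auto simp: dist_real_def\<close>)

lemma product_continuous:
  "0 \<le> x \<Longrightarrow> x \<le> a \<Longrightarrow> continuous_on {0..x} (\<lambda>y. k x y * u y)"
  by (intro continuous_intros k_continuous continuous_on_subset[OF u_cont]) auto

lemma cell_continuous:
  assumes "1 \<le> j" "j \<le> m" "m \<le> N"
  shows "continuous_on {0..1} (\<lambda>t. k (real m * h) (real j * h - t * h) * u (real j * h - t * h))"
  by (rule continuous_on_compose2[OF product_continuous[of "real m * h"]])
     (use h assms grid_le cell_in[OF assms] in \<open>auto intro!: continuous_intros\<close>)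

lemma quad_diff_continuous:
  "1 \<le> j \<Longrightarrow> j \<le> m \<Longrightarrow> m \<le> N \<Longrightarrow> continuous_on {0..1} (quad_diff k u h m j)"
  unfolding quad_diff_def[abs_def] by (intro continuous_intros cell_continuous)

text \<open>The oscillation of u and that of k over a cell contribute L U h powr \<beta> each, the
  latter through h \<le> h powr \<beta>. Passing to the next row gains a factor h in both, for k by
  the mixed bound, and n h \<le> a removes n.\<close>

lemma quad_error_holder:
  assumes hol: "\<And>x y. x \<in> {0..a} \<Longrightarrow> y \<in> {0..a} \<Longrightarrow> \<bar>u x - u y\<bar> \<le> U * \<bar>x - y\<bar> powr \<beta>"
    and \<beta>: "0 < \<beta>" "\<beta> \<le> 1" and n: "n \<le> N"
  shows "\<bar>\<Sum>j=1..n. conv (weight_inv \<alpha>) (\<lambda>i. moment \<alpha> i (quad_diff k u h (j + i) j)) (n - j)\<bar>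
    \<le> (7 + 2 * a) * (2 * L * U * h powr \<beta>)"
proof -
  have h\<beta>: "h \<le> h powr \<beta>"
    using powr_mono'[of \<beta> 1 h] h(1,2) \<beta> by simp
  have du: "\<bar>u y - u z\<bar> \<le> U * h powr \<beta>" if "y \<in> {0..a}" "z \<in> {0..a}" "\<bar>y - z\<bar> \<le> h" for y z
    by (rule order_trans[OF hol[OF that(1,2)]])
       (intro mult_left_mono powr_mono2 that(3) U_nonneg abs_ge_zero less_imp_le[OF \<beta>(1)])
  have "\<bar>\<Sum>j=1..n. conv (weight_inv \<alpha>) (\<lambda>i. moment \<alpha> i (quad_diff k u h (j + i) j)) (n - j)\<bar>
    \<le> (7 + 2 * real n * h) * (2 * L * U * h powr \<beta>)"
  proof (rule sum_conv_moment_le[OF \<alpha>, where F = "quad_diff k u h"])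
    fix m j t assume j: "1 \<le> j" "j \<le> (m :: nat)" "m < n" and t: "t \<in> {0..1::real}"
    define x w y z where xw: "x = real m * h" "w = real (Suc m) * h"
      and yz: "y = real j * h - t * h" "z = (real j - 1/2) * h"
    have y: "y \<in> {0..a}" "0 \<le> y" "y \<le> x" and z: "z \<in> {0..a}" "0 \<le> z" "z \<le> x"
      unfolding yz xw using cell_in[of j m t] midpoint_in[of j m] j t n by auto
    have x: "x \<le> w" "w \<le> a" "w - x = h"
      unfolding xw using grid_mono[of m "Suc m"] grid_le[of "Suc m"] j n by (auto simp: algebra_simps)
    have d: "\<bar>y - z\<bar> \<le> h"
      unfolding yz by (rule cell(3)[OF j(1) t])
    have "quad_diff k u h (Suc m) j t - quad_diff k u h m j t
        = (k w y - k x y) * (u y - u z) + ((k w y - k x y) - (k w z - k x z)) * u z"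
      unfolding quad_diff_def yz[symmetric] xw[symmetric] by (rule product_diff_diff)
    also have "\<bar>\<dots>\<bar> \<le> (L * h) * (U * h powr \<beta>) + (L * h * h) * U"
      by (rule order_trans[OF abs_triangle_ineq], unfold abs_mult)
         (intro add_mono mult_mono du k_step(1)[OF y(2,3) x(1,2), unfolded x(3)] y(1) z(1) d
           k_cell_step(1)[OF y(2,3) z(2,3) x(1,2) d, unfolded x(3)] u_bound[OF z(1)] abs_ge_zero
           mult_nonneg_nonneg L_nonneg U_nonneg less_imp_le[OF h(1)])
    also have "\<dots> \<le> (L * h) * (U * h powr \<beta>) + (L * h * h powr \<beta>) * U"
      by (intro add_mono mult_right_mono mult_left_mono h\<beta> order_refl
            mult_nonneg_nonneg L_nonneg U_nonneg less_imp_le[OF h(1)])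
    finally show "\<bar>quad_diff k u h (Suc m) j t - quad_diff k u h m j t\<bar> \<le> h * (2 * L * U * h powr \<beta>)"
      by (simp add: mult_ac)
  next
    fix j t assume j: "1 \<le> j" "j \<le> n" and t: "t \<in> {0..1::real}"
    define x y z where x: "x = real j * h"
      and yz: "y = real j * h - t * h" "z = (real j - 1/2) * h"
    have y: "y \<in> {0..a}" "0 \<le> y" "y \<le> x" and z: "z \<in> {0..a}" "0 \<le> z" "z \<le> x" and xa: "x \<le> a"
      unfolding yz x using cell_in[of j j t] midpoint_in[of j j] grid_le[of j] j t n by auto
    have d: "\<bar>y - z\<bar> \<le> h"
      unfolding yz by (rule cell(3)[OF j(1) t])
    have dk: "\<bar>k x y - k x z\<bar> \<le> L * h powr \<beta>"
      by (rule order_trans[OF k_cell(1)[OF y(2,3) z(2,3) xa d]]) (intro mult_left_mono h\<beta> L_nonneg)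
    have "quad_diff k u h j j t = k x y * (u y - u z) + (k x y - k x z) * u z"
      unfolding quad_diff_def yz[symmetric] unfolding x[symmetric] by (rule product_diff)
    also have "\<bar>\<dots>\<bar> \<le> L * (U * h powr \<beta>) + (L * h powr \<beta>) * U"
      by (rule order_trans[OF abs_triangle_ineq], unfold abs_mult)
         (intro add_mono mult_mono du dk k_bound[OF y(2,3) xa] y(1) z(1) d u_bound[OF z(1)] abs_ge_zero
           mult_nonneg_nonneg L_nonneg U_nonneg powr_ge_zero)
    finally show "\<bar>quad_diff k u h j j t\<bar> \<le> 2 * L * U * h powr \<beta>"
      by (simp add: mult_ac)
  next
    show "continuous_on {0..1} (quad_diff k u h m j)" if "1 \<le> j" "j \<le> m" "m \<le> n" for m j
      using that n by (intro quad_diff_continuous) auto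
    show "0 \<le> 2 * L * U * h powr \<beta>" "0 \<le> h"
      using L_nonneg U_nonneg h(1) by auto
  qed
  also have "\<dots> \<le> (7 + 2 * a) * (2 * L * U * h powr \<beta>)"
    using grid_le[OF n] L_nonneg U_nonneg by (intro mult_right_mono) auto
  finally show ?thesis .
qed

text \<open>With n \<le> a / h this is the price h powr (\<alpha> - 1) of partial summation.\<close>

lemma sum_weight_inv_sum_le_powr:
  assumes "n \<le> N" "0 < a"
  shows "(\<Sum>s<n. weight_inv_sum \<alpha> s) \<le> a powr (1 - \<alpha>) / (1 - \<alpha>) * h powr (\<alpha> - 1)"
proof -
  have "(1 - \<alpha>) * (\<Sum>s<n. weight_inv_sum \<alpha> s) \<le> real n powr (1 - \<alpha>)"
    by (rule sum_weight_inv_sum_le[OF \<alpha>])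
  also have "\<dots> \<le> (a / h) powr (1 - \<alpha>)"
    using grid_le[OF assms(1)] h \<alpha> by (intro powr_mono2) (auto simp: field_simps)
  also have "\<dots> = a powr (1 - \<alpha>) * h powr (\<alpha> - 1)"
    using h assms by (simp add: powr_divide powr_diff field_simps)
  finally show ?thesis
    using \<alpha> by (simp add: field_simps)
qed

end

context abel_scheme
begin

text \<open>The quadrature error is split into its part that is linear in \<open>y - x\<^sub>j\<^sub>-\<^sub>1\<^sub>/\<^sub>2\<close>, for which
  partial summation applies, and a remainder of order \<open>h powr \<gamma>\<close>.\<close>
lemma quad_error_smooth:
  fixes v :: "real \<Rightarrow> real"
  assumes u': "\<And>x. x \<in> {0..a} \<Longrightarrow> (u has_real_derivative v x) (at x within {0..a})"
    and v_bound: "\<And>x. x \<in> {0..a} \<Longrightarrow> \<bar>v x\<bar> \<le> U"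
    and hol: "\<And>x y. x \<in> {0..a} \<Longrightarrow> y \<in> {0..a} \<Longrightarrow> \<bar>v x - v y\<bar> \<le> U * \<bar>x - y\<bar> powr (\<gamma> - 1)"
    and \<gamma>: "1 < \<gamma>" "\<gamma> \<le> 2" and zero: "u 0 = 0" "v 0 = 0" and n: "1 \<le> n" "n \<le> N" and a: "0 < a"
  shows "\<bar>\<Sum>j=1..n. conv (weight_inv \<alpha>) (\<lambda>i. moment \<alpha> i (quad_diff k u h (j + i) j)) (n - j)\<bar>
    \<le> (24 + 6 * a + 15 * (a powr (1 - \<alpha>) / (1 - \<alpha>))) * (L * U) * h powr (\<gamma> - 1 + \<alpha>)"
proof -
  \<comment> \<open>The y-derivative of k x y * u y at the midpoint, so that
    \<open>h * p m j * (1/2 - t)\<close> is the linear part of the integrand.\<close>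
  define p where "p m j = k (real m * h) ((real j - 1/2) * h) * v ((real j - 1/2) * h)
    + k' (real m * h) ((real j - 1/2) * h) * u ((real j - 1/2) * h)" for m j
  define r where "r m j t = quad_diff k u h m j t - h * p m j * (1/2 - t)" for m j t
  define \<eta> where "\<eta> = h powr (\<gamma> - 1)"
  define E where "E = h powr \<gamma>"
  have h\<eta>: "h \<le> \<eta>"
    unfolding \<eta>_def using powr_mono'[of "\<gamma> - 1" 1 h] h \<gamma> by simp
  have E: "E = \<eta> * h"
    unfolding E_def \<eta>_def using h by (simp add: powr_diff)
  have hE: "h * h \<le> E"
    unfolding E using h\<eta> h by (intro mult_right_mono) auto
  have \<eta>0: "0 \<le> \<eta>" and E0: "0 \<le> E"
    by (auto simp: \<eta>_def E_def)
  have LU: "0 \<le> L * U"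
    using L_nonneg U_nonneg by simp
  have u_lip: "\<bar>u x - u y\<bar> \<le> U * \<bar>x - y\<bar>" if "x \<in> {0..a}" "y \<in> {0..a}" for x y
    using field_differentiable_bound[of "{0..a}" u v U x y] u' v_bound that by auto
  have du: "\<bar>u y - u z\<bar> \<le> U * h" if "y \<in> {0..a}" "z \<in> {0..a}" "\<bar>y - z\<bar> \<le> h" for y z
    by (rule order_trans[OF u_lip[OF that(1,2)]]) (intro mult_left_mono that(3) U_nonneg)
  have taylor: "\<bar>u y - u z - v z * (y - z)\<bar> \<le> U * E" if "y \<in> {0..a}" "z \<in> {0..a}" "\<bar>y - z\<bar> \<le> h" for y z
  proof -
    have "\<bar>u y - u z - v z * (y - z)\<bar> \<le> U * \<bar>y - z\<bar> powr (\<gamma> - 1) * \<bar>y - z\<bar>"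
      by (rule first_order_remainder[of "{0..a}"]) (use that u' hol U_nonneg \<gamma> in auto)
    also have "\<dots> \<le> U * \<eta> * h"
      unfolding \<eta>_def using \<gamma>
      by (intro mult_mono powr_mono2 mult_nonneg_nonneg order_refl that U_nonneg abs_ge_zero powr_ge_zero) auto
    finally show ?thesis by (simp add: E mult.assoc)
  qed
  \<comment> \<open>Taylor expansion of a product: the remainder of u, the remainder of k, and the
    product of the two first differences. The last two are O(h * h), hence O(E) by
    \<open>hE\<close>; the three terms give the factor 3 below.\<close>
  have r_eq: "r m j t = k (real m * h) z * (u y - u z - v z * (y - z))
      + (k (real m * h) y - k (real m * h) z - k' (real m * h) z * (y - z)) * u z
      + (k (real m * h) y - k (real m * h) z) * (u y - u z)"
    if "y = real j * h - t * h" "z = (real j - 1/2) * h" for m j t y z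
  proof -
    have "h * (1/2 - t) = y - z"
      using that by (simp add: algebra_simps)
    then have "r m j t = quad_diff k u h m j t - (y - z) * p m j"
      by (simp add: r_def mult_ac)
    also have "\<dots> = (k (real m * h) y * u y - k (real m * h) z * u z)
        - (y - z) * (k (real m * h) z * v z + k' (real m * h) z * u z)"
      by (simp only: quad_diff_def p_def that)
    finally show ?thesis
      by (simp add: algebra_simps)
  qed
  have r_cont: "continuous_on {0..1} (r m j)" if "1 \<le> j" "j \<le> m" "m \<le> N" for m j
    unfolding r_def[abs_def] by (intro continuous_intros quad_diff_continuous that)
  have "\<bar>\<Sum>j=1..n. conv (weight_inv \<alpha>) (\<lambda>i. moment \<alpha> i (r (j + i) j)) (n - j)\<bar>
      \<le> (7 + 2 * real n * h) * (3 * (L * U) * E)"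
  proof (rule sum_conv_moment_le[OF \<alpha>, where F = r])
    fix m j t assume j: "1 \<le> j" "j \<le> (m :: nat)" "m < n" and t: "t \<in> {0..1::real}"
    define x w y z where xw: "x = real m * h" "w = real (Suc m) * h"
      and yz: "y = real j * h - t * h" "z = (real j - 1/2) * h"
    have y: "y \<in> {0..a}" "0 \<le> y" "y \<le> x" and z: "z \<in> {0..a}" "0 \<le> z" "z \<le> x"
      unfolding yz xw using cell_in[of j m t] midpoint_in[of j m] j t n by auto
    have x: "x \<le> w" "w \<le> a" "w - x = h"
      unfolding xw using grid_mono[of m "Suc m"] grid_le[of "Suc m"] j n by (auto simp: algebra_simps)
    have d: "\<bar>y - z\<bar> \<le> h"
      unfolding yz by (rule cell(3)[OF j(1) t])
    have "r (Suc m) j t - r m j t = (k w z - k x z) * (u y - u z - v z * (y - z))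
        + ((k w y - k w z - k' w z * (y - z)) - (k x y - k x z - k' x z * (y - z))) * u z
        + ((k w y - k x y) - (k w z - k x z)) * (u y - u z)"
      unfolding r_eq[OF yz] xw[symmetric] by (simp add: algebra_simps)
    also have "\<bar>\<dots>\<bar> \<le> (L * h) * (U * E) + (L * h * (h * h)) * U + (L * h * h) * (U * h)"
      by (rule order_trans[OF abs_triangle_ineq add_mono[OF order_trans[OF abs_triangle_ineq add_mono]]];
          unfold abs_mult)
         (intro mult_mono taylor du k_step(1)[OF z(2,3) x(1,2), unfolded x(3)] y(1) z(1) d
           k_cell_step[OF y(2,3) z(2,3) x(1,2) d, unfolded x(3)] u_bound[OF z(1)] abs_ge_zero mult_nonneg_nonneg L_nonneg U_nonneg less_imp_le[OF h(1)])+
    also have "\<dots> = (L * U * h) * (E + h * h + h * h)"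
      by (simp add: algebra_simps)
    also have "\<dots> \<le> (L * U * h) * (E + E + E)"
      by (intro mult_left_mono add_mono hE order_refl abs_ge_zero mult_nonneg_nonneg L_nonneg U_nonneg less_imp_le[OF h(1)])
    finally show "\<bar>r (Suc m) j t - r m j t\<bar> \<le> h * (3 * (L * U) * E)"
      by (simp add: mult_ac)
  next
    fix j t assume j: "1 \<le> j" "j \<le> n" and t: "t \<in> {0..1::real}"
    define x y z where x: "x = real j * h"
      and yz: "y = real j * h - t * h" "z = (real j - 1/2) * h"
    have y: "y \<in> {0..a}" "0 \<le> y" "y \<le> x" and z: "z \<in> {0..a}" "0 \<le> z" "z \<le> x" and xa: "x \<le> a"
      unfolding yz x using cell_in[of j j t] midpoint_in[of j j] grid_le[of j] j t n by auto
    have d: "\<bar>y - z\<bar> \<le> h"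
      unfolding yz by (rule cell(3)[OF j(1) t])
    have "\<bar>r j j t\<bar> \<le> L * (U * E) + (L * (h * h)) * U + (L * h) * (U * h)"
      unfolding r_eq[OF yz] x[symmetric]
      by (rule order_trans[OF abs_triangle_ineq add_mono[OF order_trans[OF abs_triangle_ineq add_mono]]];
          unfold abs_mult)
         (intro mult_mono taylor du k_bound[OF z(2,3) xa] y(1) z(1) d
           k_cell[OF y(2,3) z(2,3) xa d] u_bound[OF z(1)] abs_ge_zero mult_nonneg_nonneg L_nonneg U_nonneg less_imp_le[OF h(1)])+
    also have "\<dots> = (L * U) * (E + h * h + h * h)"
      by (simp add: algebra_simps)
    also have "\<dots> \<le> (L * U) * (E + E + E)"
      by (intro mult_left_mono add_mono hE order_refl abs_ge_zero mult_nonneg_nonneg L_nonneg U_nonneg less_imp_le[OF h(1)])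
    finally show "\<bar>r j j t\<bar> \<le> 3 * (L * U) * E"
      by (simp add: mult_ac)
  next
    show "continuous_on {0..1} (r m j)" if "1 \<le> j" "j \<le> m" "m \<le> n" for m j
      using that n by (intro r_cont) auto
    show "0 \<le> 3 * (L * U) * E" "0 \<le> h"
      using LU E0 h(1) by auto
  qed
  also have "\<dots> \<le> (7 + 2 * a) * (3 * (L * U) * E)"
    using grid_le[OF n(2)] LU E0 by (intro mult_right_mono) auto
  finally have R: "\<bar>\<Sum>j=1..n. conv (weight_inv \<alpha>) (\<lambda>i. moment \<alpha> i (r (j + i) j)) (n - j)\<bar>
      \<le> (7 + 2 * a) * (3 * (L * U) * E)" .

  let ?S = "\<Sum>s<n. weight_inv_sum \<alpha> s"
  have "\<bar>\<Sum>j=1..n. conv (weight_inv \<alpha>) (\<lambda>i. centered_moment \<alpha> i * p (j + i) j) (n - j)\<bar>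
      \<le> 3 / 2 * (2 * (L * U) * \<eta>) + (3 / 2 * (6 * (L * U) * \<eta>) + 3 * (2 * (L * U) * \<eta>)) * ?S"
  proof (rule sum_conv_centered_moment_le[OF \<alpha> n(1)])
    define z where "z = (real 1 - 1/2) * h"
    have z: "z \<in> {0..a}" "z \<le> real 1 * h" "real 1 * h \<le> a"
      unfolding z_def using midpoint_in[of 1 1] n grid_le[of 1] by auto
    have zh: "0 \<le> z" "z \<le> h"
      using z by auto
    \<comment> \<open>The boundary term at the first midpoint: \<open>v 0 = 0\<close> makes v of
      order h powr (\<gamma> - 1) there, and \<open>u 0 = 0\<close> does the same for u.\<close>
    have "\<bar>v z\<bar> \<le> U * z powr (\<gamma> - 1)"
      using hol[of z 0] z zero a by auto
    also have "\<dots> \<le> U * \<eta>"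
      unfolding \<eta>_def using zh U_nonneg \<gamma> by (intro mult_left_mono powr_mono2) auto
    finally have vz: "\<bar>v z\<bar> \<le> U * \<eta>" .
    have "\<bar>u z\<bar> \<le> U * z"
      using u_lip[of z 0] z zero a by auto
    also have "\<dots> \<le> U * \<eta>"
      using zh h\<eta> U_nonneg by (intro mult_left_mono) auto
    finally have uz: "\<bar>u z\<bar> \<le> U * \<eta>" .
    have kz: "\<bar>k (real 1 * h) z\<bar> \<le> L" "\<bar>k' (real 1 * h) z\<bar> \<le> L"
      using k_bound[of z "real 1 * h"] k'_bound[of z "real 1 * h"] z by auto
    have "\<bar>p 1 1\<bar> \<le> L * (U * \<eta>) + L * (U * \<eta>)"
      unfolding p_def z_def[symmetric]
      by (rule order_trans[OF abs_triangle_ineq add_mono]; unfold abs_mult)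
         (intro mult_mono vz uz kz abs_ge_zero mult_nonneg_nonneg L_nonneg U_nonneg less_imp_le[OF h(1)])+
    then show "\<bar>p 1 1\<bar> \<le> 2 * (L * U) * \<eta>"
      by (simp add: algebra_simps)
  next
    fix j assume j: "1 \<le> j" "j < n"
    define y z where yz_def: "y = (real (Suc j) - 1/2) * h" "z = (real j - 1/2) * h"
    let ?x = "real j * h" and ?x' = "real (Suc j) * h"
    have y: "y \<in> {0..a}" "y \<le> ?x'" and z: "z \<in> {0..a}" "z \<le> ?x" and x: "?x \<le> a" "?x' \<le> a"
      unfolding yz_def using midpoint_in[of j j] midpoint_in[of "Suc j" "Suc j"] grid_le[of j]
        grid_le[of "Suc j"] j n by auto
    have d: "\<bar>?x' - ?x\<bar> + \<bar>y - z\<bar> = h + h" and yz: "\<bar>y - z\<bar> \<le> h"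
      using h(1) by (auto simp: yz_def algebra_simps)
    have \<eta>2: "L * (h + h) \<le> 2 * L * \<eta>"
      using mult_left_mono[OF h\<eta> L_nonneg] by simp
    have dk: "\<bar>k ?x' y - k ?x z\<bar> \<le> 2 * L * \<eta>" "\<bar>k' ?x' y - k' ?x z\<bar> \<le> 2 * L * \<eta>"
      by (rule order_trans[OF k_lip order_trans[OF _ \<eta>2]] order_trans[OF k'_lip order_trans[OF _ \<eta>2]];
          use y z x d in simp)+
    have kz: "\<bar>k ?x z\<bar> \<le> L" "\<bar>k' ?x z\<bar> \<le> L"
      using k_bound[of z ?x] k'_bound[of z ?x] z x by auto
    have dv: "\<bar>v y - v z\<bar> \<le> U * \<eta>"
      unfolding \<eta>_def using \<gamma>
      by (intro order_trans[OF hol[OF y(1) z(1)]] mult_left_mono powr_mono2 yz U_nonneg abs_ge_zero) auto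
    have du\<eta>: "\<bar>u y - u z\<bar> \<le> U * \<eta>"
      by (rule order_trans[OF du[OF y(1) z(1) yz]]) (intro mult_left_mono h\<eta> U_nonneg)
    have "p (Suc j) (Suc j) - p j j = (k ?x' y - k ?x z) * v y + k ?x z * (v y - v z)
        + (k' ?x' y - k' ?x z) * u y + k' ?x z * (u y - u z)"
      unfolding p_def yz_def[symmetric] by (simp add: algebra_simps)
    also have "\<bar>\<dots>\<bar> \<le> (2 * L * \<eta>) * U + L * (U * \<eta>) + (2 * L * \<eta>) * U + L * (U * \<eta>)"
      by (rule order_trans[OF abs_triangle_ineq add_mono[OF order_trans[OF abs_triangle_ineq
            add_mono[OF order_trans[OF abs_triangle_ineq add_mono]]]]]; unfold abs_mult)
         (intro mult_mono dk kz dv du\<eta> u_bound[OF y(1)] v_bound[OF y(1)] \<eta>0 zero_le_numeral abs_ge_zero mult_nonneg_nonneg L_nonneg U_nonneg less_imp_le[OF h(1)])+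
    finally show "\<bar>p (Suc j) (Suc j) - p j j\<bar> \<le> 6 * (L * U) * \<eta>"
      by (simp add: algebra_simps)
  next
    fix m j assume j: "1 \<le> j" "j \<le> m" "m < n"
    define z where "z = (real j - 1/2) * h"
    let ?x = "real m * h" and ?x' = "real (Suc m) * h"
    have z: "z \<in> {0..a}" "z \<le> ?x" and x: "?x \<le> ?x'" "?x' \<le> a"
      unfolding z_def using midpoint_in[of j m] grid_le[of "Suc m"] grid_mono[of m "Suc m"] j n by auto
    have d: "?x' - ?x = h"
      by (simp add: algebra_simps)
    have L\<eta>: "L * h \<le> L * \<eta>"
      by (intro mult_left_mono h\<eta> L_nonneg)
    have dk: "\<bar>k ?x' z - k ?x z\<bar> \<le> L * \<eta>" "\<bar>k' ?x' z - k' ?x z\<bar> \<le> L * \<eta>"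
      using order_trans[OF k_step(1)[of z ?x ?x', unfolded d] L\<eta>]
        order_trans[OF k_step(2)[of z ?x ?x', unfolded d] L\<eta>] z x by auto
    have "p (Suc m) j - p m j = (k ?x' z - k ?x z) * v z + (k' ?x' z - k' ?x z) * u z"
      unfolding p_def z_def[symmetric] by (simp add: algebra_simps)
    also have "\<bar>\<dots>\<bar> \<le> (L * \<eta>) * U + (L * \<eta>) * U"
      by (rule order_trans[OF abs_triangle_ineq add_mono]; unfold abs_mult)
         (intro mult_mono dk u_bound[OF z(1)] v_bound[OF z(1)] \<eta>0 abs_ge_zero mult_nonneg_nonneg L_nonneg U_nonneg less_imp_le[OF h(1)])+
    finally show "\<bar>p (Suc m) j - p m j\<bar> \<le> 2 * (L * U) * \<eta>"
      by (simp add: algebra_simps)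
  qed (use LU \<eta>0 in auto)
  \<comment> \<open>The 15 is 9 from the increments along the diagonal plus 6 from those between
    rows; the 3 is the boundary term.\<close>
  also have "\<dots> = (L * U) * \<eta> * (3 + 15 * ?S)"
    by (simp add: algebra_simps)
  finally have C: "\<bar>\<Sum>j=1..n. conv (weight_inv \<alpha>) (\<lambda>i. centered_moment \<alpha> i * p (j + i) j) (n - j)\<bar>
      \<le> (L * U) * \<eta> * (3 + 15 * ?S)" .

  have split: "conv (weight_inv \<alpha>) (\<lambda>i. moment \<alpha> i (quad_diff k u h (j + i) j)) (n - j)
      = conv (weight_inv \<alpha>) (\<lambda>i. moment \<alpha> i (r (j + i) j)) (n - j)
        + h * conv (weight_inv \<alpha>) (\<lambda>i. centered_moment \<alpha> i * p (j + i) j) (n - j)"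
    if j: "j \<in> {1..n}" for j
    unfolding conv_cmult[symmetric] conv_add[symmetric]
  proof (rule conv_cong)
    fix i assume i: "i \<le> n - j"
    have "moment \<alpha> i (r (j + i) j) = moment \<alpha> i (quad_diff k u h (j + i) j)
        - moment \<alpha> i (\<lambda>t. h * p (j + i) j * (1/2 - t))"
      unfolding r_def[abs_def]
      by (intro moment_diff[OF \<alpha>] quad_diff_continuous continuous_intros) (use i j n in auto)
    then show "moment \<alpha> i (quad_diff k u h (j + i) j)
        = moment \<alpha> i (r (j + i) j) + h * (centered_moment \<alpha> i * p (j + i) j)"
      by (simp add: moment_cmult[OF \<alpha>] centered_moment_def)
  qed
  have "\<bar>\<Sum>j=1..n. conv (weight_inv \<alpha>) (\<lambda>i. moment \<alpha> i (quad_diff k u h (j + i) j)) (n - j)\<bar>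
      = \<bar>(\<Sum>j=1..n. conv (weight_inv \<alpha>) (\<lambda>i. moment \<alpha> i (r (j + i) j)) (n - j))
        + h * (\<Sum>j=1..n. conv (weight_inv \<alpha>) (\<lambda>i. centered_moment \<alpha> i * p (j + i) j) (n - j))\<bar>"
    using split by (simp add: sum.distrib sum_distrib_left)
  also have "\<dots> \<le> (7 + 2 * a) * (3 * (L * U) * E) + h * ((L * U) * \<eta> * (3 + 15 * ?S))"
    by (rule order_trans[OF abs_triangle_ineq add_mono[OF R]])
       (use h C in \<open>simp add: abs_mult mult_left_mono\<close>)
  also have "\<dots> = (L * U) * ((24 + 6 * a) * E + 15 * (E * ?S))"
    by (simp add: E algebra_simps)
  also have "\<dots> \<le> (L * U) * ((24 + 6 * a) * h powr (\<gamma> - 1 + \<alpha>)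
      + 15 * (a powr (1 - \<alpha>) / (1 - \<alpha>) * h powr (\<gamma> - 1 + \<alpha>)))"
  proof (intro mult_left_mono add_mono LU)
    show "E \<le> h powr (\<gamma> - 1 + \<alpha>)"
      unfolding E_def using h \<alpha> by (intro powr_mono') auto
    \<comment> \<open>Here the order is decided: h powr \<gamma> from the linear part and its
      increments, times the price h powr (\<alpha> - 1).\<close>
    have "E * ?S \<le> E * (a powr (1 - \<alpha>) / (1 - \<alpha>) * h powr (\<alpha> - 1))"
      by (intro mult_left_mono sum_weight_inv_sum_le_powr n a E0)
    also have "\<dots> = a powr (1 - \<alpha>) / (1 - \<alpha>) * h powr (\<gamma> - 1 + \<alpha>)"
      unfolding E_def using powr_add[of h \<gamma> "\<alpha> - 1"] by (simp add: algebra_simps)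
    finally show "E * ?S \<le> a powr (1 - \<alpha>) / (1 - \<alpha>) * h powr (\<gamma> - 1 + \<alpha>)" .
  qed (use a in auto)
  finally show ?thesis
    by (simp add: algebra_simps)
qed

end

section \<open>Convergence rates\<close>

context abel_scheme
begin

text \<open>Subtracting the normalized integral equation from the scheme shows that the error solves
  the weighted system with noise plus quadrature error on the right. Stability and the l1 bound of
  the inverse weights do the rest.\<close>

lemma max_error_le:
  assumes sol: "abel_solution \<alpha> a k f u" and k1: "\<forall>x\<in>{0..a}. k x x = 1"
    and step: "step a N = h" and "0 < N" and \<delta>: "0 \<le> \<delta>"
    and noisy: "noisy_data a f N \<delta> g" and scheme: "midpoint_scheme \<alpha> a k N g v"
    and small: "6 * (L * h) \<le> 1"
    and Q: "\<And>n. 1 \<le> n \<Longrightarrow> n \<le> N \<Longrightarrow>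
      \<bar>\<Sum>j=1..n. conv (weight_inv \<alpha>) (\<lambda>i. moment \<alpha> i (quad_diff k u h (j + i) j)) (n - j)\<bar> \<le> Q"
  shows "max_error a N u v \<le> 2 * (2 * (Gamma (\<alpha> + 1) * (\<delta> * h powr - \<alpha>)) + Q) * exp (6 * L * a)"
proof -
  define \<Gamma> where "\<Gamma> = Gamma (\<alpha> + 1)"
  have \<Gamma>: "0 < \<Gamma>" "\<Gamma> = \<alpha> * Gamma \<alpha>" "0 < Gamma \<alpha>"
    using \<alpha> nonpos_Ints_nonpos[of \<alpha>] by (auto simp: \<Gamma>_def Gamma_real_pos intro!: Gamma_plus1)
  define K where "K m j = k (real m * h) ((real j - 1/2) * h)" for m j
  define b\<^sub>1 where "b\<^sub>1 m = h powr - \<alpha> * \<Gamma> * (g m - f (real m * h))" for m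
  define b\<^sub>2 where "b\<^sub>2 m = (\<Sum>j=1..m. moment \<alpha> (m - j) (quad_diff k u h m j))" for m
  define e where "e j = v j - u ((real j - 1/2) * h)" for j
  have grid: "grid a N s = s * h" for s
    by (simp add: grid_def step)
  have hh: "h powr - \<alpha> * h powr \<alpha> = 1"
    using h(1) by (simp add: powr_minus)
  \<comment> \<open>Multiplication by Gamma (\<alpha> + 1) h powr - \<alpha> turns
    \<open>omega\<close> into \<open>weight\<close>; this factor is what amplifies the
    noise.\<close>
  have discrete: "(\<Sum>j=1..m. weight \<alpha> (m - j) * K m j * v j) = h powr - \<alpha> * \<Gamma> * g m"
    if "1 \<le> m" "m \<le> N" for m
  proof -
    let ?A = "\<Sum>j=1..m. omega \<alpha> (m - j) * K m j * v j"
    have g: "g m = h powr \<alpha> * ?A"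
      using scheme that unfolding midpoint_scheme_def grid step K_def by auto
    have "\<Gamma> * ?A = (\<Sum>j=1..m. weight \<alpha> (m - j) * K m j * v j)"
      unfolding sum_distrib_left using \<Gamma>(1)
      by (intro sum.cong) (auto simp: omega_def weight_def \<Gamma>_def)
    moreover have "h powr - \<alpha> * \<Gamma> * g m = (h powr - \<alpha> * h powr \<alpha>) * (\<Gamma> * ?A)"
      unfolding g by (simp only: mult_ac)
    ultimately have "h powr - \<alpha> * \<Gamma> * g m
        = (h powr - \<alpha> * h powr \<alpha>) * (\<Sum>j=1..m. weight \<alpha> (m - j) * K m j * v j)"
      by simp
    then show ?thesis
      by (simp add: hh)
  qed
  have continuous: "(\<Sum>j=1..m. moment \<alpha> (m - j) (\<lambda>t. k (real m * h) (real j * h - t * h) * u (real j * h - t * h)))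
      = h powr - \<alpha> * \<Gamma> * f (real m * h)" (is "?M m = _") if m: "1 \<le> m" "m \<le> N" for m
  proof -
    have x: "0 \<le> real m * h" "real m * h \<le> a"
      using h(1) grid_le[OF m(2)] by auto
    have "((\<lambda>y. \<alpha> * (real m * h - y) powr (\<alpha> - 1) * (k (real m * h) y * u y)) has_integral
        h powr \<alpha> * ?M m) {0..real m * h}"
      by (rule abel_integral_eq_moments[OF \<alpha> h(1)]) (rule product_continuous[OF x])
    then have "((\<lambda>y. \<alpha> * ((real m * h - y) powr (\<alpha> - 1) * k (real m * h) y * u y)) has_integral
        h powr \<alpha> * ?M m) {0..real m * h}"
      by (simp only: mult.assoc)
    from integral_unique[OF this]
    have "\<alpha> * integral {0..real m * h} (\<lambda>y. (real m * h - y) powr (\<alpha> - 1) * k (real m * h) y * u y)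
        = h powr \<alpha> * ?M m"
      by (simp only: integral_mult_right)
    moreover have "1 / Gamma \<alpha> * integral {0..real m * h}
        (\<lambda>y. (real m * h - y) powr (\<alpha> - 1) * k (real m * h) y * u y) = f (real m * h)"
      using sol x unfolding abel_solution_def by auto
    ultimately have "\<Gamma> * f (real m * h) = h powr \<alpha> * ?M m"
      using \<Gamma> by (auto simp: field_simps)
    then have "h powr - \<alpha> * \<Gamma> * f (real m * h) = (h powr - \<alpha> * h powr \<alpha>) * ?M m"
      by (simp add: mult.assoc)
    then show ?thesis
      by (simp add: hh)
  qed
  have sys: "(\<Sum>j=1..m. weight \<alpha> (m - j) * K m j * e j) = b\<^sub>1 m + b\<^sub>2 m" if m: "1 \<le> m" "m \<le> N" for m
  proof -
    have "moment \<alpha> (m - j) (quad_diff k u h m j)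
        = moment \<alpha> (m - j) (\<lambda>t. k (real m * h) (real j * h - t * h) * u (real j * h - t * h))
          - weight \<alpha> (m - j) * K m j * u ((real j - 1/2) * h)" if "j \<in> {1..m}" for j
      unfolding quad_diff_def[abs_def] K_def
      using that m by (subst moment_diff[OF \<alpha>]) (auto simp: moment_const[OF \<alpha>] intro!: cell_continuous)
    then have "b\<^sub>2 m = h powr - \<alpha> * \<Gamma> * f (real m * h)
        - (\<Sum>j=1..m. weight \<alpha> (m - j) * K m j * u ((real j - 1/2) * h))"
      unfolding b\<^sub>2_def continuous[OF m, symmetric] by (simp add: sum_subtractf)
    moreover have "(\<Sum>j=1..m. weight \<alpha> (m - j) * K m j * e j) = h powr - \<alpha> * \<Gamma> * g m
        - (\<Sum>j=1..m. weight \<alpha> (m - j) * K m j * u ((real j - 1/2) * h))"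
      unfolding discrete[OF m, symmetric] e_def by (simp add: sum_subtractf right_diff_distrib)
    ultimately show ?thesis
      by (simp add: b\<^sub>1_def algebra_simps)
  qed
  have rhs: "\<bar>\<Sum>m=1..n. weight_inv \<alpha> (n - m) * (b\<^sub>1 m + b\<^sub>2 m)\<bar> \<le> 2 * (\<Gamma> * (\<delta> * h powr - \<alpha>)) + Q"
    if n: "1 \<le> n" "n \<le> N" for n
  proof -
    have "\<bar>\<Sum>m=1..n. weight_inv \<alpha> (n - m) * b\<^sub>1 m\<bar> \<le> 2 * (\<Gamma> * (\<delta> * h powr - \<alpha>))"
    proof (rule conv_noise_le[OF \<alpha>])
      fix m assume "1 \<le> m" "m \<le> n"
      then have "\<bar>g m - f (real m * h)\<bar> \<le> \<delta>"
        using noisy n unfolding noisy_data_def grid by auto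
      then have "h powr - \<alpha> * \<Gamma> * \<bar>g m - f (real m * h)\<bar> \<le> h powr - \<alpha> * \<Gamma> * \<delta>"
        using \<Gamma>(1) by (intro mult_left_mono) auto
      then show "\<bar>b\<^sub>1 m\<bar> \<le> \<Gamma> * (\<delta> * h powr - \<alpha>)"
        using \<Gamma>(1) by (simp add: b\<^sub>1_def abs_mult mult_ac)
    qed (use \<delta> \<Gamma>(1) in auto)
    moreover have "(\<Sum>m=1..n. weight_inv \<alpha> (n - m) * b\<^sub>2 m)
        = (\<Sum>j=1..n. conv (weight_inv \<alpha>) (\<lambda>i. moment \<alpha> i (quad_diff k u h (j + i) j)) (n - j))"
      using sum_conv_swap[of "weight_inv \<alpha>" n "\<lambda>m j. moment \<alpha> (m - j) (quad_diff k u h m j)"]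
      by (simp add: b\<^sub>2_def)
    ultimately show ?thesis
      unfolding distrib_left sum.distrib using Q[OF n]
      by (intro order_trans[OF abs_triangle_ineq add_mono]) auto
  qed
  have err: "\<bar>e n\<bar> \<le> 2 * (2 * (\<Gamma> * (\<delta> * h powr - \<alpha>)) + Q) * exp (6 * (L * h) * real N)"
    if n: "1 \<le> n" "n \<le> N" for n
  proof (rule weighted_system_stable[OF \<alpha> sys _ _ rhs _ small n])
    fix j assume j: "1 \<le> j" "j \<le> N"
    \<comment> \<open>The diagonal entries use k at distance h / 2 from the diagonal of the
      triangle, where k is 1, so they differ from 1 by O(h).\<close>
    have "k (real j * h) (real j * h) = 1"
      using k1 h(1) grid_le[OF j(2)] by auto
    then have "\<bar>K j j - 1\<bar> = \<bar>k (real j * h) ((real j - 1/2) * h) - k (real j * h) (real j * h)\<bar>"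
      by (simp add: K_def)
    also have "\<dots> \<le> L * h"
      by (rule k_cell(1))
         (use midpoint_in[of j j] j h(1) grid_le[OF j(2)] in \<open>auto simp: algebra_simps\<close>)
    finally show "\<bar>K j j - 1\<bar> \<le> L * h" .
  next
    fix m j assume j: "1 \<le> j" "j \<le> m" "m < N"
    have d: "real (Suc m) * h - real m * h = h"
      by (simp add: algebra_simps)
    show "\<bar>K (Suc m) j - K m j\<bar> \<le> L * h"
      unfolding K_def
      by (rule k_step(1)[of "(real j - 1/2) * h" "real m * h" "real (Suc m) * h", unfolded d])
         (use midpoint_in[of j m] grid_mono[of m "Suc m"] grid_le[of "Suc m"] j in auto)
  qed (use L_nonneg h(1) in auto)
  \<comment> \<open>As N h = a, the Gronwall factor is independent of the step size.\<close>
  have exp_eq: "6 * (L * h) * real N = 6 * L * a"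
    by (simp add: h(3)[symmetric] mult_ac)
  show ?thesis
    unfolding max_error_def
  proof (rule Max.boundedI)
    show "(\<lambda>n. \<bar>v n - u (grid a N (real n - 1/2))\<bar>) ` {1..N} \<noteq> {}"
      using \<open>0 < N\<close> by auto
  qed (use err in \<open>auto simp: grid e_def exp_eq \<Gamma>_def\<close>)
qed

end

section \<open>Uniform bounds for members of the function space\<close>

lemma F_space_bounded:
  assumes "u \<in> F_space \<gamma> 0 a" "0 < a"
  obtains m \<beta> D U where "\<gamma> = real m + \<beta>" "0 < \<beta>" "\<beta> \<le> 1" "\<And>x. x \<in> {0..a} \<Longrightarrow> D 0 x = u x"
    "\<And>i x. i < m \<Longrightarrow> x \<in> {0..a} \<Longrightarrow> (D i has_real_derivative D (Suc i) x) (at x within {0..a})"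
    "\<And>i. i \<le> m \<Longrightarrow> continuous_on {0..a} (D i)"
    "\<And>i x. i \<le> m \<Longrightarrow> x \<in> {0..a} \<Longrightarrow> \<bar>D i x\<bar> \<le> U"
    "\<And>x y. x \<in> {0..a} \<Longrightarrow> y \<in> {0..a} \<Longrightarrow> \<bar>D m x - D m y\<bar> \<le> U * \<bar>x - y\<bar> powr \<beta>"
proof -
  obtain m \<beta> D M where D: "\<gamma> = real m + \<beta>" "0 < \<beta>" "\<beta> \<le> 1" "\<forall>x\<in>{0..a}. D 0 x = u x"
    "\<forall>i<m. \<forall>x\<in>{0..a}. (D i has_real_derivative D (Suc i) x) (at x within {0..a})"
    "continuous_on {0..a} (D m)" "M \<ge> 0"
    "\<forall>x\<in>{0..a}. \<forall>y\<in>{0..a}. \<bar>D m x - D m y\<bar> \<le> M * \<bar>x - y\<bar> powr \<beta>"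
    using assms(1) unfolding F_space_def by blast
  have cont: "continuous_on {0..a} (D i)" if "i \<le> m" for i
    using D(5,6) that by (cases "i = m") (auto intro!: DERIV_continuous_on[where D = "D (Suc i)"])
  have "\<exists>B. \<forall>x\<in>{0..a}. \<bar>D i x\<bar> \<le> B" if "i \<le> m" for i
  proof -
    have "bounded (D i ` {0..a})"
      by (intro compact_imp_bounded compact_continuous_image cont that) auto
    then show ?thesis
      unfolding bounded_iff by auto
  qed
  then obtain B where B: "\<And>i x. i \<le> m \<Longrightarrow> x \<in> {0..a} \<Longrightarrow> \<bar>D i x\<bar> \<le> B i"
    by metis
  define U where "U = (\<Sum>i\<le>m. \<bar>B i\<bar>) + M"
  have "\<bar>D i x\<bar> \<le> U" if "i \<le> m" "x \<in> {0..a}" for i x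
  proof -
    have "\<bar>B i\<bar> \<le> (\<Sum>i\<le>m. \<bar>B i\<bar>)"
      using that by (intro member_le_sum) auto
    then show ?thesis
      using B[OF that] D(7) unfolding U_def by linarith
  qed
  moreover have "\<bar>D m x - D m y\<bar> \<le> U * \<bar>x - y\<bar> powr \<beta>" if "x \<in> {0..a}" "y \<in> {0..a}" for x y
  proof -
    have "M * \<bar>x - y\<bar> powr \<beta> \<le> U * \<bar>x - y\<bar> powr \<beta>"
      unfolding U_def by (intro mult_right_mono) (auto intro: sum_nonneg)
    then show ?thesis
      using D(8) that by fastforce
  qed
  ultimately show ?thesis
    using that[of m \<beta> D U] D cont by blast
qed

text \<open>For m = 0 the exponent is \<gamma> = \<beta> \<le> 1. For m \<ge> 1 the first derivative
  is bounded, so u is Lipschitz, and \<gamma> > 1.\<close>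

lemma F_space_holder:
  assumes "u \<in> F_space \<gamma> 0 a" "0 < a"
  obtains U where "continuous_on {0..a} u" "\<And>x. x \<in> {0..a} \<Longrightarrow> \<bar>u x\<bar> \<le> U"
    "\<And>x y. x \<in> {0..a} \<Longrightarrow> y \<in> {0..a} \<Longrightarrow> \<bar>u x - u y\<bar> \<le> U * \<bar>x - y\<bar> powr min \<gamma> 1"
proof -
  obtain m \<beta> D U where D: "\<gamma> = real m + \<beta>" "0 < \<beta>" "\<beta> \<le> 1" "\<And>x. x \<in> {0..a} \<Longrightarrow> D 0 x = u x"
    "\<And>i x. i < m \<Longrightarrow> x \<in> {0..a} \<Longrightarrow> (D i has_real_derivative D (Suc i) x) (at x within {0..a})"
    "\<And>i. i \<le> m \<Longrightarrow> continuous_on {0..a} (D i)"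
    "\<And>i x. i \<le> m \<Longrightarrow> x \<in> {0..a} \<Longrightarrow> \<bar>D i x\<bar> \<le> U"
    "\<And>x y. x \<in> {0..a} \<Longrightarrow> y \<in> {0..a} \<Longrightarrow> \<bar>D m x - D m y\<bar> \<le> U * \<bar>x - y\<bar> powr \<beta>"
    using F_space_bounded[OF assms] by blast
  have "\<bar>D 0 x - D 0 y\<bar> \<le> U * \<bar>x - y\<bar> powr min \<gamma> 1" if xy: "x \<in> {0..a}" "y \<in> {0..a}" for x y
  proof (cases "m = 0")
    case True
    then show ?thesis
      using D(8)[OF xy] D(1,3) by (simp add: min_absorb1)
  next
    case False
    have "norm (D 0 x - D 0 y) \<le> U * norm (x - y)"
      by (rule field_differentiable_bound[of "{0..a}" _ "D 1"])
         (use False xy D(5)[of 0] D(7)[of 1] in auto)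
    moreover have "min \<gamma> 1 = 1"
      using False D(1,2) by simp
    ultimately show ?thesis
      by simp
  qed
  moreover have "continuous_on {0..a} u"
    using D(6)[of 0] D(4) continuous_on_cong[of "{0..a}" "{0..a}" "D 0" u] by simp
  ultimately show ?thesis
    using that[of U] D(4) D(7)[of 0] by simp
qed

text \<open>The range 1 < \<gamma> \<le> 2 forces m = 1, including \<gamma> = 2, which decomposes
  with \<beta> = 1.\<close>

lemma F_space_C1:
  assumes "u \<in> F_space \<gamma> 0 a" "0 < a" "1 < \<gamma>" "\<gamma> \<le> 2"
  obtains v U where "continuous_on {0..a} u" "\<And>x. x \<in> {0..a} \<Longrightarrow> \<bar>u x\<bar> \<le> U"
    "\<And>x. x \<in> {0..a} \<Longrightarrow> (u has_real_derivative v x) (at x within {0..a})"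
    "\<And>x. x \<in> {0..a} \<Longrightarrow> \<bar>v x\<bar> \<le> U"
    "\<And>x y. x \<in> {0..a} \<Longrightarrow> y \<in> {0..a} \<Longrightarrow> \<bar>v x - v y\<bar> \<le> U * \<bar>x - y\<bar> powr (\<gamma> - 1)"
proof -
  obtain m \<beta> D U where D: "\<gamma> = real m + \<beta>" "0 < \<beta>" "\<beta> \<le> 1" "\<And>x. x \<in> {0..a} \<Longrightarrow> D 0 x = u x"
    "\<And>i x. i < m \<Longrightarrow> x \<in> {0..a} \<Longrightarrow> (D i has_real_derivative D (Suc i) x) (at x within {0..a})"
    "\<And>i. i \<le> m \<Longrightarrow> continuous_on {0..a} (D i)"
    "\<And>i x. i \<le> m \<Longrightarrow> x \<in> {0..a} \<Longrightarrow> \<bar>D i x\<bar> \<le> U"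
    "\<And>x y. x \<in> {0..a} \<Longrightarrow> y \<in> {0..a} \<Longrightarrow> \<bar>D m x - D m y\<bar> \<le> U * \<bar>x - y\<bar> powr \<beta>"
    using F_space_bounded[OF assms(1,2)] by blast
  have m: "m = 1"
    using D(1-3) assms(3,4) by linarith
  have "(u has_real_derivative D 1 x) (at x within {0..a})" if "x \<in> {0..a}" for x
    using D(5)[of 0 x] D(4) that m
    by (auto intro: has_field_derivative_transform_within[where d = 1])
  moreover have "continuous_on {0..a} u"
    using D(6)[of 0] D(4) continuous_on_cong[of "{0..a}" "{0..a}" "D 0" u] by simp
  moreover have "\<beta> = \<gamma> - 1"
    using D(1) m by simp
  ultimately show ?thesis
    using that[of U "D 1"] D(4) D(7)[of 0] D(7)[of 1] D(8) m by simp
qed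

text \<open>For h of order \<delta> powr (1 / \<theta>) both terms of the bound are of order
  \<delta> powr (1 - \<alpha> / \<theta>). The lower bound on h, through \<open>c\<^sub>2\<close>,
  controls the noise term; the upper bound, through \<open>c\<^sub>1\<close>, controls the
  quadrature term.\<close>

lemma step_sim_rate:
  assumes sim: "step_sim a N (1 / \<theta>)" and N: "\<forall>\<delta>>0. 0 < N \<delta>" and a: "0 < a"
    and \<alpha>: "0 < \<alpha>" "\<alpha> \<le> \<theta>" and C: "0 \<le> C" and h\<^sub>0: "0 < h\<^sub>0"
    and bound: "\<And>n \<delta> g v. 0 < n \<Longrightarrow> 0 < \<delta> \<Longrightarrow> step a n \<le> h\<^sub>0 \<Longrightarrow> noisy_data a f n \<delta> g \<Longrightarrow>
      midpoint_scheme \<alpha> a k n g v \<Longrightarrow>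
      max_error a n u v \<le> C * (\<delta> * step a n powr - \<alpha> + step a n powr (\<theta> - \<alpha>))"
  shows "\<exists>C. \<forall>\<^sub>F \<delta> in at_right 0. \<forall>g v. noisy_data a f (N \<delta>) \<delta> g \<and> midpoint_scheme \<alpha> a k (N \<delta>) g v \<longrightarrow>
    max_error a (N \<delta>) u v \<le> C * \<delta> powr (1 - \<alpha> / \<theta>)"
proof -
  obtain c\<^sub>1 c\<^sub>2 where c: "0 < c\<^sub>1" "c\<^sub>1 \<le> c\<^sub>2"
    and ev: "\<forall>\<^sub>F \<delta> in at_right 0. c\<^sub>1 * step a (N \<delta>) \<le> \<delta> powr (1 / \<theta>) \<and> \<delta> powr (1 / \<theta>) \<le> c\<^sub>2 * step a (N \<delta>)"
    using sim unfolding step_sim_def by blast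
  have \<theta>: "0 < \<theta>"
    using \<alpha> by simp
  have "0 < (c\<^sub>1 * h\<^sub>0) powr \<theta>"
    using c h\<^sub>0 by simp
  \<comment> \<open>Below this threshold the relation between h and \<delta> forces the step size
    under \<open>h\<^sub>0\<close>.\<close>
  then have "\<forall>\<^sub>F \<delta> in at_right 0. \<delta> \<in> {0<..<(c\<^sub>1 * h\<^sub>0) powr \<theta>}"
    by (rule eventually_at_right_real)
  with ev have "\<forall>\<^sub>F \<delta> in at_right 0. \<forall>g v. noisy_data a f (N \<delta>) \<delta> g \<and> midpoint_scheme \<alpha> a k (N \<delta>) g v \<longrightarrow>
    max_error a (N \<delta>) u v \<le> C * (c\<^sub>2 powr \<alpha> + c\<^sub>1 powr - (\<theta> - \<alpha>)) * \<delta> powr (1 - \<alpha> / \<theta>)"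
  proof eventually_elim
    case (elim \<delta>)
    let ?h = "step a (N \<delta>)"
    have \<delta>: "0 < \<delta>" "\<delta> < (c\<^sub>1 * h\<^sub>0) powr \<theta>"
      using elim by auto
    have h: "0 < ?h"
      using N \<delta> a by (simp add: step_def)
    have "\<delta> powr (1 / \<theta>) \<le> ((c\<^sub>1 * h\<^sub>0) powr \<theta>) powr (1 / \<theta>)"
      using \<delta> \<theta> by (intro powr_mono2) auto
    also have "\<dots> = c\<^sub>1 * h\<^sub>0"
      using c h\<^sub>0 \<theta> by (simp add: powr_powr)
    finally have "c\<^sub>1 * ?h \<le> c\<^sub>1 * h\<^sub>0"
      using elim by linarith
    then have hh\<^sub>0: "?h \<le> h\<^sub>0"
      using c by simp
    have exponents: "(\<delta> powr (1 / \<theta>)) powr - \<alpha> * \<delta> = \<delta> powr (1 - \<alpha> / \<theta>)"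
      "(\<delta> powr (1 / \<theta>)) powr (\<theta> - \<alpha>) = \<delta> powr (1 - \<alpha> / \<theta>)"
      using \<delta> \<theta> powr_add[of \<delta> "- \<alpha> / \<theta>" 1] by (simp_all add: powr_powr diff_divide_distrib)
    have "(c\<^sub>2 * ?h) powr - \<alpha> \<le> (\<delta> powr (1 / \<theta>)) powr - \<alpha>"
      using elim \<delta> \<alpha> by (intro powr_mono2') auto
    then have "c\<^sub>2 powr - \<alpha> * ?h powr - \<alpha> \<le> (\<delta> powr (1 / \<theta>)) powr - \<alpha>"
      using c h by (simp add: powr_mult)
    then have "c\<^sub>2 powr - \<alpha> * ?h powr - \<alpha> * \<delta> \<le> \<delta> powr (1 - \<alpha> / \<theta>)"
      unfolding exponents(1)[symmetric] using \<delta> by (intro mult_right_mono) auto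
    then have "c\<^sub>2 powr \<alpha> * (c\<^sub>2 powr - \<alpha> * ?h powr - \<alpha> * \<delta>) \<le> c\<^sub>2 powr \<alpha> * \<delta> powr (1 - \<alpha> / \<theta>)"
      by (intro mult_left_mono) auto
    moreover have "c\<^sub>2 powr \<alpha> * c\<^sub>2 powr - \<alpha> = 1"
      using c by (simp add: powr_minus)
    then have "c\<^sub>2 powr \<alpha> * (c\<^sub>2 powr - \<alpha> * ?h powr - \<alpha> * \<delta>) = \<delta> * ?h powr - \<alpha>"
      by (simp only: mult.assoc[symmetric]) simp
    ultimately have 1: "\<delta> * ?h powr - \<alpha> \<le> c\<^sub>2 powr \<alpha> * \<delta> powr (1 - \<alpha> / \<theta>)"
      by simp
    have "(c\<^sub>1 * ?h) powr (\<theta> - \<alpha>) \<le> (\<delta> powr (1 / \<theta>)) powr (\<theta> - \<alpha>)"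
      using elim h c \<alpha> by (intro powr_mono2) auto
    then have "c\<^sub>1 powr (\<theta> - \<alpha>) * ?h powr (\<theta> - \<alpha>) \<le> \<delta> powr (1 - \<alpha> / \<theta>)"
      unfolding exponents(2) using c h by (simp add: powr_mult)
    then have 2: "?h powr (\<theta> - \<alpha>) \<le> c\<^sub>1 powr - (\<theta> - \<alpha>) * \<delta> powr (1 - \<alpha> / \<theta>)"
      unfolding powr_minus using c by (simp add: field_simps)
    show ?case
    proof (intro allI impI)
      fix g v assume "noisy_data a f (N \<delta>) \<delta> g \<and> midpoint_scheme \<alpha> a k (N \<delta>) g v"
      then have "max_error a (N \<delta>) u v \<le> C * (\<delta> * ?h powr - \<alpha> + ?h powr (\<theta> - \<alpha>))"
        using N \<delta> hh\<^sub>0 by (intro bound) auto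
      also have "\<dots> \<le> C * (c\<^sub>2 powr \<alpha> * \<delta> powr (1 - \<alpha> / \<theta>) + c\<^sub>1 powr - (\<theta> - \<alpha>) * \<delta> powr (1 - \<alpha> / \<theta>))"
        by (intro mult_left_mono add_mono 1 2 C)
      finally show "max_error a (N \<delta>) u v
          \<le> C * (c\<^sub>2 powr \<alpha> + c\<^sub>1 powr - (\<theta> - \<alpha>)) * \<delta> powr (1 - \<alpha> / \<theta>)"
        by (simp add: algebra_simps)
    qed
  qed
  then show ?thesis
    by blast
qed

text \<open>The abstract form of both parts: \<open>\<tau>\<close> is the order of the quadrature error after
  inversion of the weights.\<close>
lemma midpoint_rate:
  assumes \<alpha>: "0 < \<alpha>" "\<alpha> < 1" and a: "0 < a"
    and kernel: "smooth_kernel a k k' L" and k1: "\<forall>x\<in>{0..a}. k x x = 1"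
    and sol: "abel_solution \<alpha> a k f u"
    and u: "continuous_on {0..a} u" "\<And>x. x \<in> {0..a} \<Longrightarrow> \<bar>u x\<bar> \<le> U"
    and Q: "\<And>h N n. abel_scheme a k k' L \<alpha> h U u N \<Longrightarrow> 1 \<le> n \<Longrightarrow> n \<le> N \<Longrightarrow>
      \<bar>\<Sum>j=1..n. conv (weight_inv \<alpha>) (\<lambda>i. moment \<alpha> i (quad_diff k u h (j + i) j)) (n - j)\<bar>
        \<le> C * h powr \<tau>"
    and C: "0 \<le> C" and \<theta>: "\<theta> = \<tau> + \<alpha>" "0 \<le> \<tau>"
    and N: "\<forall>\<delta>>0. 0 < N \<delta>" and sim: "step_sim a N (1 / \<theta>)"
  shows "\<exists>C. \<forall>\<^sub>F \<delta> in at_right 0. \<forall>g v. noisy_data a f (N \<delta>) \<delta> g \<and> midpoint_scheme \<alpha> a k (N \<delta>) g v \<longrightarrow>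
    max_error a (N \<delta>) u v \<le> C * \<delta> powr (1 - \<alpha> / \<theta>)"
proof (rule step_sim_rate[OF sim N a \<alpha>(1)])
  interpret smooth_kernel a k k' L
    by (rule kernel)
  let ?C = "(4 * Gamma (\<alpha> + 1) + 2 * C) * exp (6 * L * a)"
  have \<Gamma>: "0 \<le> Gamma (\<alpha> + 1)"
    using \<alpha> by (intro less_imp_le Gamma_real_pos) auto
  show "0 \<le> ?C"
    using C \<Gamma> by simp
  \<comment> \<open>A step size up to this value satisfies both h \<le> 1 and 6 L h \<le> 1, as the
    locale and the stability estimate require.\<close>
  show "0 < 1 / (6 * L + 1)"
    using L_nonneg by simp
  fix n \<delta> g v
  assume n: "0 < n" and \<delta>: "0 < \<delta>" and small: "step a n \<le> 1 / (6 * L + 1)"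
    and noisy: "noisy_data a f n \<delta> g" and scheme: "midpoint_scheme \<alpha> a k n g v"
  let ?h = "step a n"
  have hpos: "0 < ?h"
    using n a by (simp add: step_def)
  have "?h * (6 * L + 1) \<le> 1"
    using small L_nonneg by (simp add: field_simps)
  moreover have "0 \<le> ?h * (6 * L)"
    using hpos L_nonneg by simp
  ultimately have h_small: "?h \<le> 1" "6 * (L * ?h) \<le> 1"
    using hpos by (simp_all add: algebra_simps)
  interpret abel_scheme a k k' L \<alpha> ?h U u n
    by unfold_locales (use \<alpha> hpos h_small n u in \<open>auto simp: step_def\<close>)
  have "max_error a n u v
      \<le> 2 * (2 * (Gamma (\<alpha> + 1) * (\<delta> * ?h powr - \<alpha>)) + C * ?h powr \<tau>) * exp (6 * L * a)"
    by (rule max_error_le[OF sol k1 refl n less_imp_le[OF \<delta>] noisy scheme h_small(2) Q])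
       (rule abel_scheme_axioms)
  also have "\<dots> = (4 * Gamma (\<alpha> + 1) * (\<delta> * ?h powr - \<alpha>) + 2 * C * ?h powr \<tau>) * exp (6 * L * a)"
    by (simp add: algebra_simps)
  also have "\<dots> \<le> ((4 * Gamma (\<alpha> + 1) + 2 * C) * (\<delta> * ?h powr - \<alpha>)
      + (4 * Gamma (\<alpha> + 1) + 2 * C) * ?h powr \<tau>) * exp (6 * L * a)"
    using C \<Gamma> \<delta> by (intro mult_right_mono add_mono) auto
  also have "\<dots> = ?C * (\<delta> * ?h powr - \<alpha> + ?h powr (\<theta> - \<alpha>))"
    by (simp add: \<theta>(1) algebra_simps)
  finally show "max_error a n u v \<le> ?C * (\<delta> * ?h powr - \<alpha> + ?h powr (\<theta> - \<alpha>))" .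
qed (use \<theta> in auto)

theorem corollary3p5:
  fixes \<alpha> a \<gamma> :: real
    and k :: "real \<Rightarrow> real \<Rightarrow> real"
    and f u :: "real \<Rightarrow> real"
  assumes "0 < \<alpha>" "\<alpha> < 1" "0 < a"
    and "min \<alpha> (1 - \<alpha>) < \<gamma>" "\<gamma> \<le> 2"
    and "lipschitz_partials 2 a k"
    and "\<forall>x\<in>{0..a}. k x x = 1"
    and "u \<in> F_space \<gamma> 0 a"
    and "abel_solution \<alpha> a k f u"
  shows
    "(\<alpha> \<le> 1/2 \<and> \<alpha> < \<gamma> \<and> \<gamma> \<le> \<alpha> + 1 \<longrightarrow>
       (\<forall>N :: real \<Rightarrow> nat. (\<forall>\<delta>>0. 0 < N \<delta>) \<and> step_sim a N (1 / \<gamma>) \<longrightarrow>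
         (\<exists>C. \<forall>\<^sub>F \<delta> in at_right 0. \<forall>g v.
            noisy_data a f (N \<delta>) \<delta> g \<and> midpoint_scheme \<alpha> a k (N \<delta>) g v \<longrightarrow>
            max_error a (N \<delta>) u v \<le> C * \<delta> powr (1 - \<alpha> / \<gamma>))))
     \<and>
     ((\<alpha> \<ge> 1/2 \<and> 1 - \<alpha> < \<gamma> \<and> \<gamma> \<le> 2 - \<alpha>) \<or>
      (\<gamma> > 2 - \<alpha> \<and> u 0 = 0 \<and> (u has_real_derivative 0) (at 0 within {0..a})) \<longrightarrow>
       (\<forall>N :: real \<Rightarrow> nat. (\<forall>\<delta>>0. 0 < N \<delta>) \<and> step_sim a N (1 / (\<gamma> - 1 + 2 * \<alpha>)) \<longrightarrow>
         (\<exists>C. \<forall>\<^sub>F \<delta> in at_right 0. \<forall>g v.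
            noisy_data a f (N \<delta>) \<delta> g \<and> midpoint_scheme \<alpha> a k (N \<delta>) g v \<longrightarrow>
            max_error a (N \<delta>) u v \<le> C * \<delta> powr (1 - \<alpha> / (\<gamma> - 1 + 2 * \<alpha>)))))"
proof -
  note \<alpha> = assms(1,2) and a = assms(3) and k1 = assms(7) and F = assms(8) and sol = assms(9)
  obtain k' L where kernel: "smooth_kernel a k k' L"
    using lipschitz_partials_imp_smooth_kernel[OF a assms(6)] by blast
  have L: "0 \<le> L"
    using kernel by (simp add: smooth_kernel_def)
  have \<gamma>: "0 < \<gamma>"
    using assms(4) \<alpha> by (auto simp: min_def split: if_splits)
  have holder_rate: "\<exists>C. \<forall>\<^sub>F \<delta> in at_right 0. \<forall>g v.
      noisy_data a f (N \<delta>) \<delta> g \<and> midpoint_scheme \<alpha> a k (N \<delta>) g v \<longrightarrow>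
      max_error a (N \<delta>) u v \<le> C * \<delta> powr (1 - \<alpha> / \<theta>)"
    if \<theta>: "\<theta> = \<tau> + \<alpha>" "0 \<le> \<tau>" "\<tau> \<le> min \<gamma> 1"
      and N: "\<forall>\<delta>>0. 0 < N \<delta>" "step_sim a N (1 / \<theta>)" for \<theta> \<tau> and N :: "real \<Rightarrow> nat"
  proof -
    obtain U where U: "continuous_on {0..a} u" "\<And>x. x \<in> {0..a} \<Longrightarrow> \<bar>u x\<bar> \<le> U"
      "\<And>x y. x \<in> {0..a} \<Longrightarrow> y \<in> {0..a} \<Longrightarrow> \<bar>u x - u y\<bar> \<le> U * \<bar>x - y\<bar> powr min \<gamma> 1"
      by (rule F_space_holder[OF F a]) (rule that)
    have "\<bar>u 0\<bar> \<le> U"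
      using U(2) a by auto
    then have C: "0 \<le> (7 + 2 * a) * (2 * L * U)"
      using L a by simp
    show ?thesis
    proof (rule midpoint_rate[OF \<alpha> a kernel k1 sol U(1,2) _ C \<theta>(1,2) N])
      fix h M n assume "abel_scheme a k k' L \<alpha> h U u M" and n: "1 \<le> n" "n \<le> M"
      then interpret abel_scheme a k k' L \<alpha> h U u M
        by simp
      have "\<bar>\<Sum>j=1..n. conv (weight_inv \<alpha>) (\<lambda>i. moment \<alpha> i (quad_diff k u h (j + i) j)) (n - j)\<bar>
          \<le> (7 + 2 * a) * (2 * L * U * h powr min \<gamma> 1)"
        by (rule quad_error_holder[OF U(3)]) (use \<gamma> n in auto)
      also have "\<dots> = (7 + 2 * a) * (2 * L * U) * h powr min \<gamma> 1"
        by (simp add: mult.assoc)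
      also have "\<dots> \<le> (7 + 2 * a) * (2 * L * U) * h powr \<tau>"
        using h \<theta>(3) by (intro mult_left_mono C powr_mono') auto
      finally show "\<bar>\<Sum>j=1..n. conv (weight_inv \<alpha>) (\<lambda>i. moment \<alpha> i (quad_diff k u h (j + i) j)) (n - j)\<bar>
          \<le> (7 + 2 * a) * (2 * L * U) * h powr \<tau>" .
    qed
  qed
  have smooth_rate: "\<exists>C. \<forall>\<^sub>F \<delta> in at_right 0. \<forall>g v.
      noisy_data a f (N \<delta>) \<delta> g \<and> midpoint_scheme \<alpha> a k (N \<delta>) g v \<longrightarrow>
      max_error a (N \<delta>) u v \<le> C * \<delta> powr (1 - \<alpha> / (\<gamma> - 1 + 2 * \<alpha>))"
    if \<gamma>2: "\<gamma> > 2 - \<alpha>" and u0: "u 0 = 0" "(u has_real_derivative 0) (at 0 within {0..a})"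
      and N: "\<forall>\<delta>>0. 0 < N \<delta>" "step_sim a N (1 / (\<gamma> - 1 + 2 * \<alpha>))" for N :: "real \<Rightarrow> nat"
  proof -
    have \<gamma>1: "1 < \<gamma>"
      using \<gamma>2 \<alpha> by simp
    obtain v U where U: "continuous_on {0..a} u" "\<And>x. x \<in> {0..a} \<Longrightarrow> \<bar>u x\<bar> \<le> U"
      "\<And>x. x \<in> {0..a} \<Longrightarrow> (u has_real_derivative v x) (at x within {0..a})"
      "\<And>x. x \<in> {0..a} \<Longrightarrow> \<bar>v x\<bar> \<le> U"
      "\<And>x y. x \<in> {0..a} \<Longrightarrow> y \<in> {0..a} \<Longrightarrow> \<bar>v x - v y\<bar> \<le> U * \<bar>x - y\<bar> powr (\<gamma> - 1)"
      by (rule F_space_C1[OF F a \<gamma>1 assms(5)]) (rule that)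
    \<comment> \<open>The one-sided derivative on a nondegenerate interval is unique, so the
      derivative from the function space agrees with the assumed one at 0.\<close>
    have v0: "v 0 = 0"
      using vector_derivative_unique_within_closed_interval[of 0 a 0 u "v 0" 0] U(3)[of 0] u0(2) a
      by (simp add: has_real_derivative_iff_has_vector_derivative)
    let ?K = "24 + 6 * a + 15 * (a powr (1 - \<alpha>) / (1 - \<alpha>))"
    have "\<bar>u 0\<bar> \<le> U"
      using U(2) a by auto
    then have C: "0 \<le> ?K * (L * U)"
      using L a \<alpha> by simp
    show ?thesis
    proof (rule midpoint_rate[OF \<alpha> a kernel k1 sol U(1,2) _ C _ _ N])
      fix h M n assume "abel_scheme a k k' L \<alpha> h U u M" and n: "1 \<le> n" "n \<le> M"
      then interpret abel_scheme a k k' L \<alpha> h U u M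
        by simp
      show "\<bar>\<Sum>j=1..n. conv (weight_inv \<alpha>) (\<lambda>i. moment \<alpha> i (quad_diff k u h (j + i) j)) (n - j)\<bar>
          \<le> ?K * (L * U) * h powr (\<gamma> - 1 + \<alpha>)"
        by (rule quad_error_smooth[OF U(3,4,5) \<gamma>1 assms(5) u0(1) v0 n a])
    qed (use \<gamma>1 \<alpha> in auto)
  qed
  show ?thesis
    \<comment> \<open>The conditions \<gamma> \<le> \<alpha> + 1 and \<gamma> \<le> 2 - \<alpha> say
      that \<tau> \<le> 1 for the respective \<tau>; \<tau> \<le> \<gamma> follows from 0 < \<alpha>
      < 1, and the lower bounds on \<gamma> give \<tau> \<ge> 0.\<close>
    using holder_rate[of \<gamma> "\<gamma> - \<alpha>"] holder_rate[of "\<gamma> - 1 + 2 * \<alpha>" "\<gamma> - 1 + \<alpha>"] smooth_rate \<alpha>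
    by auto
qed

end
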